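(* Let $n\ge 3$ and $d\ge 1$ be integers and let $D_{2n}=\langle x,y : x^2=y^n=1,\ xy=y^{-1}x\rangle$ be the dihedral group of order $2n$. (1) If $d$ is odd and $n\mid d$, then $\mathsf{s}_{d\mathbb{N}}(D_{2n})=2d+\lfloor \log_2 n\rfloor$. (2) If $\gcd(n,d)=1$, then $\mathsf{s}_{d\mathbb{N}}(D_{2n})=nd+1$.
   Context: A sequence over a finite group $G$ is a finite unordered list of elements of $G$ with repetition allowed (an element of the free abelian monoid on $G$); its length is the number of terms counted with multiplicity, and a subsequence is a sub-multiset. A sequence $g_1,\dots,g_\ell$ is called a $1$-product sequence if $g_{\tau(1)}g_{\tau(2)}\cdots g_{\tau(\ell)}=1$ for some permutation $\tau$ of $\{1,\dots,\ell\}$. For a positive integer $d$, $\mathsf{s}_{d\mathbb{N}}(G)$ denotes the smallest $\ell\in\mathbb{N}_0\cup\{+\infty\}$ such that every sequence over $G$ of length at least $\ell$ has a nonempty $1$-product subsequence $T$ whose length $|T|$ satisfies $|T|\equiv 0 \pmod d$. $\lfloor t\rfloor$ denotes the largest integer not exceeding $t$. *)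

theory Defs
  imports
    Complex_Main
    "HOL-Library.Multiset"
    "HOL-Library.Extended_Nat"
    "HOL-Number_Theory.Cong"
    "HOL-Algebra.Coset"
begin

section \<open>Groups given by generators and relations\<close>

text \<open>A letter \<open>(g, True)\<close> stands for the generator \<open>g\<close> and \<open>(g, False)\<close> for its inverse.
  A relation is a pair of words, read as an equation.\<close>

type_synonym 'g word = "('g \<times> bool) list"

inductive pres_eq :: "('g word \<times> 'g word) set \<Rightarrow> 'g word \<Rightarrow> 'g word \<Rightarrow> bool"
  for R :: "('g word \<times> 'g word) set"
where
  rel: "(u, v) \<in> R \<Longrightarrow> pres_eq R u v"
| cancel: "pres_eq R [(g, b), (g, \<not> b)] []"
| refl: "pres_eq R u u"
| sym: "pres_eq R u v \<Longrightarrow> pres_eq R v u"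
| trans: "pres_eq R u v \<Longrightarrow> pres_eq R v w \<Longrightarrow> pres_eq R u w"
| append: "pres_eq R u u' \<Longrightarrow> pres_eq R v v' \<Longrightarrow> pres_eq R (u @ v) (u' @ v')"

definition pres_class :: "('g word \<times> 'g word) set \<Rightarrow> 'g word \<Rightarrow> 'g word set" where
  "pres_class R u = {v. pres_eq R u v}"

definition presented_group :: "('g word \<times> 'g word) set \<Rightarrow> 'g word set monoid" where
  "presented_group R =
    \<lparr>carrier = range (pres_class R),
     monoid.mult = (\<lambda>A B. {w. \<exists>u\<in>A. \<exists>v\<in>B. pres_eq R (u @ v) w}),
     one = pres_class R []\<rparr>"

lemma pres_class_eq_iff: "pres_class R u = pres_class R v \<longleftrightarrow> pres_eq R u v"
  unfolding pres_class_def by (blast intro: pres_eq.refl pres_eq.sym pres_eq.trans)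

lemma presented_group_mult:
  "pres_class R u \<otimes>\<^bsub>presented_group R\<^esub> pres_class R v = pres_class R (u @ v)"
  unfolding presented_group_def pres_class_def
  by (auto intro: pres_eq.refl pres_eq.trans pres_eq.append)

lemma presented_group_one: "\<one>\<^bsub>presented_group R\<^esub> = pres_class R []"
  by (simp add: presented_group_def)

lemma presented_group_carrier: "carrier (presented_group R) = range (pres_class R)"
  by (simp add: presented_group_def)

lemma pres_eq_left_inverse: "\<exists>v. pres_eq R (v @ u) []"
proof (induction u)
  case Nil
  show ?case by (metis append_Nil pres_eq.refl)
next
  case (Cons a u)
  obtain g b where a: "a = (g, b)" by (cases a)
  obtain v where v: "pres_eq R (v @ u) []" using Cons by blast
  have "pres_eq R ([(g, \<not> b), (g, b)] @ u) ([] @ u)"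
    using pres_eq.cancel[of R g "\<not> b"] by (intro pres_eq.append pres_eq.refl) simp
  then have "pres_eq R (v @ [(g, \<not> b), (g, b)] @ u) (v @ [] @ u)"
    by (rule pres_eq.append[OF pres_eq.refl])
  then have "pres_eq R ((v @ [(g, \<not> b)]) @ a # u) []"
    using v a by (auto intro: pres_eq.trans)
  then show ?case by blast
qed

lemma group_presented_group: "group (presented_group R)"
proof (rule groupI)
  show "\<exists>y\<in>carrier (presented_group R). y \<otimes>\<^bsub>presented_group R\<^esub> x = \<one>\<^bsub>presented_group R\<^esub>"
    if x: "x \<in> carrier (presented_group R)" for x
  proof -
    obtain u where u: "x = pres_class R u" using x by (auto simp: presented_group_carrier)
    obtain v where "pres_eq R (v @ u) []" using pres_eq_left_inverse by blast
    then have "pres_class R v \<otimes>\<^bsub>presented_group R\<^esub> x = \<one>\<^bsub>presented_group R\<^esub>"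
      by (simp add: u presented_group_mult presented_group_one pres_class_eq_iff)
    then show ?thesis by (auto simp: presented_group_carrier)
  qed
qed (auto simp: presented_group_carrier presented_group_mult presented_group_one)


section \<open>The dihedral group\<close>

datatype dihedral_gen = Gen_x | Gen_y

definition dihedral_rels :: "nat \<Rightarrow> (dihedral_gen word \<times> dihedral_gen word) set" where
  "dihedral_rels n =
    {([(Gen_x, True), (Gen_x, True)], []),
     (replicate n (Gen_y, True), []),
     ([(Gen_x, True), (Gen_y, True)], [(Gen_y, False), (Gen_x, True)])}"

definition dihedral_group :: "nat \<Rightarrow> dihedral_gen word set monoid" where
  "dihedral_group n = presented_group (dihedral_rels n)"

lemma group_dihedral_group: "group (dihedral_group n)"
  unfolding dihedral_group_def by (rule group_presented_group)

text \<open>The order is computed with normal forms; these are separated by the action on the integers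
  modulo \<open>n\<close> in which \<open>x\<close> negates and \<open>y\<close> adds one.\<close>

fun dihedral_act :: "dihedral_gen word \<Rightarrow> int \<Rightarrow> int" where
  "dihedral_act [] k = k"
| "dihedral_act ((Gen_x, b) # w) k = - dihedral_act w k"
| "dihedral_act ((Gen_y, b) # w) k = dihedral_act w k + (if b then 1 else -1)"

definition dihedral_nf :: "nat \<Rightarrow> bool \<Rightarrow> dihedral_gen word" where
  "dihedral_nf i b = replicate i (Gen_y, True) @ (if b then [(Gen_x, True)] else [])"

lemma dihedral_act_append: "dihedral_act (u @ v) k = dihedral_act u (dihedral_act v k)"
  by (induction u k rule: dihedral_act.induct) auto

lemma dihedral_act_replicate: "dihedral_act (replicate i (Gen_y, True)) k = k + int i"
  by (induction i) auto

lemma dihedral_act_cong: "[j = k] (mod m) \<Longrightarrow> [dihedral_act u j = dihedral_act u k] (mod m)"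
  by (induction u k rule: dihedral_act.induct) (auto intro: cong_add cong_diff simp: cong_minus_minus_iff)

lemma pres_eq_dihedral_act:
  "pres_eq (dihedral_rels n) u v \<Longrightarrow> [dihedral_act u k = dihedral_act v k] (mod int n)"
proof (induction arbitrary: k rule: pres_eq.induct)
  case (rel u v)
  then show ?case
    by (auto simp: dihedral_rels_def dihedral_act_replicate cong_iff_dvd_diff)
next
  case (cancel g b)
  show ?case by (cases g; cases b) auto
next
  case (append u u' v v')
  then show ?case
    unfolding dihedral_act_append by (meson cong_trans dihedral_act_cong)
qed (auto intro: cong_sym cong_trans)

lemma dihedral_nf_inj:
  assumes "n \<ge> 3" "i < n" "j < n" "pres_eq (dihedral_rels n) (dihedral_nf i b) (dihedral_nf j c)"
  shows "i = j \<and> b = c"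
proof -
  have act: "dihedral_act (dihedral_nf i b) k = (if b then int i - k else int i + k)" for i b k
    by (auto simp: dihedral_nf_def dihedral_act_append dihedral_act_replicate)
  note A = pres_eq_dihedral_act[OF assms(4), unfolded act]
  have "[int i = int j] (mod int n)" using A[of 0] by (auto split: if_splits)
  then have ij: "i = j" using assms(2,3) by (simp add: cong_int_iff cong_def)
  have "b = c"
  proof (rule ccontr)
    assume "b \<noteq> c"
    then have "int n dvd 2 \<or> int n dvd - 2"
      using A[of 1] ij by (auto simp: cong_iff_dvd_diff split: if_splits)
    then have "int n dvd 2" by auto
    then have "int n \<le> 2" by (rule zdvd_imp_le) simp
    then show False using assms(1) by simp
  qed
  with ij show ?thesis by simp
qed

definition dihedral_x :: "nat \<Rightarrow> dihedral_gen word set" where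
  "dihedral_x n = pres_class (dihedral_rels n) [(Gen_x, True)]"

definition dihedral_y :: "nat \<Rightarrow> dihedral_gen word set" where
  "dihedral_y n = pres_class (dihedral_rels n) [(Gen_y, True)]"

lemma dihedral_xy_carrier:
  "dihedral_x n \<in> carrier (dihedral_group n)" "dihedral_y n \<in> carrier (dihedral_group n)"
  by (auto simp: dihedral_x_def dihedral_y_def dihedral_group_def presented_group_carrier)

lemma pres_class_inv:
  "pres_class R [(g, False)] = inv\<^bsub>presented_group R\<^esub> pres_class R [(g, True)]"
proof (rule group.inv_equality[OF group_presented_group, symmetric])
  show "pres_class R [(g, False)] \<otimes>\<^bsub>presented_group R\<^esub> pres_class R [(g, True)]
      = \<one>\<^bsub>presented_group R\<^esub>"
    using pres_eq.cancel[of R g False]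
    by (simp add: presented_group_mult presented_group_one pres_class_eq_iff)
qed (auto simp: presented_group_carrier)

lemma pres_class_replicate:
  "pres_class R (replicate i (g, True)) = pres_class R [(g, True)] [^]\<^bsub>presented_group R\<^esub> i"
proof (induction i)
  case 0
  show ?case
    by (simp add: presented_group_one group.is_monoid[OF group_presented_group] monoid.nat_pow_0)
next
  case (Suc i)
  have "pres_class R (replicate (Suc i) (g, True))
      = pres_class R (replicate i (g, True)) \<otimes>\<^bsub>presented_group R\<^esub> pres_class R [(g, True)]"
    by (simp add: presented_group_mult replicate_append_same)
  with Suc show ?case
    by (simp add: group.is_monoid[OF group_presented_group] monoid.nat_pow_Suc)
qed

lemma dihedral_relations:
  "dihedral_x n \<otimes>\<^bsub>dihedral_group n\<^esub> dihedral_x n = \<one>\<^bsub>dihedral_group n\<^esub>"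
  "dihedral_y n [^]\<^bsub>dihedral_group n\<^esub> n = \<one>\<^bsub>dihedral_group n\<^esub>"
  "dihedral_x n \<otimes>\<^bsub>dihedral_group n\<^esub> dihedral_y n
    = inv\<^bsub>dihedral_group n\<^esub> dihedral_y n \<otimes>\<^bsub>dihedral_group n\<^esub> dihedral_x n"
  unfolding dihedral_group_def dihedral_x_def dihedral_y_def
    pres_class_inv[symmetric] pres_class_replicate[symmetric]
  by (simp_all add: presented_group_mult presented_group_one pres_class_eq_iff
      pres_eq.rel dihedral_rels_def)

lemma dihedral_normal_form:
  assumes "n > 0" "g \<in> carrier (dihedral_group n)"
  shows "\<exists>i<n. \<exists>b. g = pres_class (dihedral_rels n) (dihedral_nf i b)"
proof -
  define G where "G = dihedral_group n"
  define x where "x = dihedral_x n"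
  define y where "y = dihedral_y n"
  define f where "f i b = y [^]\<^bsub>G\<^esub> (i::nat) \<otimes>\<^bsub>G\<^esub> (if b then x else \<one>\<^bsub>G\<^esub>)" for i b
  interpret G: group G unfolding G_def by (rule group_dihedral_group)
  have [simp]: "x \<in> carrier G" "y \<in> carrier G"
    by (simp_all add: x_def y_def G_def dihedral_xy_carrier)
  have xx: "x \<otimes>\<^bsub>G\<^esub> x = \<one>\<^bsub>G\<^esub>" and yn: "y [^]\<^bsub>G\<^esub> n = \<one>\<^bsub>G\<^esub>"
    and xy: "x \<otimes>\<^bsub>G\<^esub> y = inv\<^bsub>G\<^esub> y \<otimes>\<^bsub>G\<^esub> x"
    using dihedral_relations[of n] by (simp_all add: x_def y_def G_def)
  have ix: "inv\<^bsub>G\<^esub> x = x" using xx by (simp add: G.inv_equality)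
  have "y [^]\<^bsub>G\<^esub> (n - 1) \<otimes>\<^bsub>G\<^esub> y = \<one>\<^bsub>G\<^esub>"
    using yn assms(1) by (metis G.nat_pow_Suc Suc_diff_1)
  then have iy: "inv\<^bsub>G\<^esub> y = y [^]\<^bsub>G\<^esub> (n - 1)" by (simp add: G.inv_equality)
  have xyi: "x \<otimes>\<^bsub>G\<^esub> y [^]\<^bsub>G\<^esub> i = y [^]\<^bsub>G\<^esub> ((n - 1) * i) \<otimes>\<^bsub>G\<^esub> x" for i :: nat
  proof (induction i)
    case (Suc i)
    have "x \<otimes>\<^bsub>G\<^esub> y [^]\<^bsub>G\<^esub> Suc i = y [^]\<^bsub>G\<^esub> ((n - 1) * i) \<otimes>\<^bsub>G\<^esub> (x \<otimes>\<^bsub>G\<^esub> y)"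
      using Suc by (simp add: G.m_assoc[symmetric])
    also have "\<dots> = y [^]\<^bsub>G\<^esub> ((n - 1) * i + (n - 1)) \<otimes>\<^bsub>G\<^esub> x"
      unfolding xy iy by (simp add: G.m_assoc G.nat_pow_mult[symmetric])
    finally show ?case by (simp add: add.commute)
  qed simp
  have y_f: "y [^]\<^bsub>G\<^esub> (k::nat) \<otimes>\<^bsub>G\<^esub> f i b = f (k + i) b" for k i b
    unfolding f_def by (simp add: G.m_assoc[symmetric] G.nat_pow_mult)
  have x_f: "x \<otimes>\<^bsub>G\<^esub> f i b = f ((n - 1) * i) (\<not> b)" for i b
    unfolding f_def
    by (simp add: G.m_assoc[symmetric] xyi) (simp add: G.m_assoc xx)
  have f_mod: "f i b = f (i mod n) b" for i b
  proof -
    have "y [^]\<^bsub>G\<^esub> (n * (i div n)) = \<one>\<^bsub>G\<^esub>"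
      using G.nat_pow_pow[of y n "i div n"] yn by simp
    then have "y [^]\<^bsub>G\<^esub> i = y [^]\<^bsub>G\<^esub> (i mod n)"
      using G.nat_pow_mult[of y "n * (i div n)" "i mod n"] by simp
    then show ?thesis by (simp add: f_def)
  qed
  have True_letters: "pres_class (dihedral_rels n) [(Gen_x, True)] = x"
    "pres_class (dihedral_rels n) [(Gen_y, True)] = y"
    unfolding x_def y_def dihedral_x_def dihedral_y_def by (rule HOL.refl)+
  have False_letters: "pres_class (dihedral_rels n) [(Gen_x, False)] = x"
    "pres_class (dihedral_rels n) [(Gen_y, False)] = y [^]\<^bsub>G\<^esub> (n - 1)"
    unfolding pres_class_inv True_letters dihedral_group_def[symmetric] G_def[symmetric]
    by (rule ix, rule iy)
  have letters: "pres_class (dihedral_rels n) [(Gen_x, b)] = x"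
    "pres_class (dihedral_rels n) [(Gen_y, b)] = y [^]\<^bsub>G\<^esub> (if b then 1 else n - 1)" for b
    by (cases b; simp add: True_letters False_letters)+
  have word: "\<exists>i b. pres_class (dihedral_rels n) w = f i b" for w
  proof (induction w)
    case Nil
    have "pres_class (dihedral_rels n) [] = f 0 False"
      by (simp add: f_def G_def dihedral_group_def presented_group_one presented_group_mult)
    then show ?case by blast
  next
    case (Cons a w)
    obtain i b where ib: "pres_class (dihedral_rels n) w = f i b" using Cons by blast
    have "pres_class (dihedral_rels n) (a # w) = pres_class (dihedral_rels n) [a] \<otimes>\<^bsub>G\<^esub> f i b"
      unfolding ib[symmetric] G_def dihedral_group_def by (simp add: presented_group_mult)
    moreover obtain h c where "a = (h, c)" by (cases a)
    ultimately show ?case by (cases h) (auto simp only: letters x_f y_f)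
  qed
  have nf: "f i b = pres_class (dihedral_rels n) (dihedral_nf i b)" for i b
    unfolding f_def dihedral_nf_def G_def dihedral_group_def x_def y_def dihedral_x_def
      dihedral_y_def pres_class_replicate[symmetric]
    by (simp add: presented_group_mult presented_group_one)
  obtain w where "g = pres_class (dihedral_rels n) w"
    using assms(2) by (auto simp: dihedral_group_def presented_group_carrier)
  then obtain i b where "g = f i b" using word by blast
  then have "g = f (i mod n) b" using f_mod[of i b] by (rule HOL.trans)
  then show ?thesis using nf assms(1) by (metis mod_less_divisor)
qed

lemma order_dihedral_group:
  assumes "n \<ge> 3"
  shows "order (dihedral_group n) = 2 * n"
proof -
  let ?f = "\<lambda>(i, b). pres_class (dihedral_rels n) (dihedral_nf i b)"
  have "carrier (dihedral_group n) = ?f ` ({..<n} \<times> UNIV)"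
  proof
    show "carrier (dihedral_group n) \<subseteq> ?f ` ({..<n} \<times> UNIV)"
    proof
      fix g assume "g \<in> carrier (dihedral_group n)"
      then obtain i b where "i < n" "g = ?f (i, b)"
        using dihedral_normal_form[of n g] assms by auto
      then show "g \<in> ?f ` ({..<n} \<times> UNIV)" by blast
    qed
  qed (auto simp: dihedral_group_def presented_group_carrier)
  moreover have "inj_on ?f ({..<n} \<times> UNIV)"
    using dihedral_nf_inj[OF assms] by (auto simp: inj_on_def pres_class_eq_iff)
  ultimately show ?thesis
    by (simp add: order_def card_image card_cartesian_product)
qed


section \<open>Sequences over a group and product-one subsequences\<close>

definition one_product_seq :: "('a, 'b) monoid_scheme \<Rightarrow> 'a multiset \<Rightarrow> bool" where
  "one_product_seq G S \<longleftrightarrow> (\<exists>gs. mset gs = S \<and> foldr (\<otimes>\<^bsub>G\<^esub>) gs \<one>\<^bsub>G\<^esub> = \<one>\<^bsub>G\<^esub>)"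

text \<open>For \<open>l = \<infinity>\<close> the condition holds vacuously, so the minimum over \<^typ>\<open>enat\<close> always exists.\<close>

definition s_dN :: "nat \<Rightarrow> ('a, 'b) monoid_scheme \<Rightarrow> enat" where
  "s_dN d G = (LEAST l::enat.
     \<forall>S. set_mset S \<subseteq> carrier G \<and> enat (size S) \<ge> l \<longrightarrow>
       (\<exists>T. T \<subseteq># S \<and> T \<noteq> {#} \<and> one_product_seq G T \<and> d dvd size T))"

end

theory Submission
  imports Defs
begin

text \<open>
  Let \<open>n\<close> be odd and divide \<open>d\<close>. Splitting off one-product sequences of length \<open>n\<close> or \<open>2n\<close> reduces
  the upper bound to \<open>d = n\<close>. A sequence of rotations and of an even, positive number of reflections
  is a one-product sequence iff the rotations can be given signs and the reflections can be paired
  so that the signed exponents and the signed differences of the pairs sum to zero modulo \<open>n\<close>.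
  Choose the largest subgroup \<open>k\<int>/n\<int>\<close> all of whose elements are signed sums of fewer than \<open>n/k\<close>
  terms (rotations or pairs) taken from that subgroup. By a greedy argument in the style of
  Cauchy and Davenport fewer than \<open>k\<close> disjoint terms of the rest are nonzero modulo \<open>k\<close>, so that
  modulo \<open>k\<close> almost everything is trivial. It then suffices to find a subsequence of length \<open>n\<close> or
  \<open>2n\<close> with signed sum zero modulo \<open>k\<close>; the exceptional terms are handled by the pigeonhole
  principle, since any \<open>t\<close> terms with \<open>2\<^sup>t > k\<close> contain a signed zero sum. If there are at most
  two reflections, the Erdos-Ginzburg-Ziv theorem applies instead.

  For coprime \<open>n\<close> and \<open>d\<close> the terms can be arranged, unless there are so many reflections that
  \<open>d\<close> pairs of equal ones exist or \<open>d = 1\<close>, into \<open>n\<close> blocks of length \<open>d\<close>, each containing an even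
  number of reflections; two of the \<open>n + 1\<close> prefix products over these blocks coincide.
\<close>

section \<open>Computing in the dihedral group\<close>

lemma dihedral_act_nf:
  "dihedral_act (dihedral_nf i b) k = (if b then int i - k else int i + k)"
  by (auto simp: dihedral_nf_def dihedral_act_append dihedral_act_replicate)

text \<open>For \<open>n >= 3\<close> the action on the integers modulo \<open>n\<close> is
  faithful: after reduction to normal form the image of 0 determines the exponent, and the image of
  1 then tells rotations from reflections because \<open>n\<close> does not divide 2.\<close>

lemma pres_eq_dihedral_iff:
  assumes "n \<ge> 3"
  shows "pres_eq (dihedral_rels n) u v \<longleftrightarrow>
    (\<forall>k. [dihedral_act u k = dihedral_act v k] (mod int n))"
proof
  assume *: "\<forall>k. [dihedral_act u k = dihedral_act v k] (mod int n)"
  have nf: "\<exists>i<n. \<exists>b. pres_eq (dihedral_rels n) w (dihedral_nf i b)" for w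
  proof -
    have "pres_class (dihedral_rels n) w \<in> carrier (dihedral_group n)"
      by (simp add: dihedral_group_def presented_group_carrier)
    from dihedral_normal_form[OF _ this] assms show ?thesis by (simp add: pres_class_eq_iff)
  qed
  obtain i b where i: "i < n" "pres_eq (dihedral_rels n) u (dihedral_nf i b)" using nf by blast
  obtain j c where j: "j < n" "pres_eq (dihedral_rels n) v (dihedral_nf j c)" using nf by blast
  have act: "[dihedral_act (dihedral_nf i b) k = dihedral_act (dihedral_nf j c) k] (mod int n)" for k
    by (rule cong_trans[OF cong_sym[OF pres_eq_dihedral_act[OF i(2)]]
          cong_trans[OF spec[OF *] pres_eq_dihedral_act[OF j(2)]]])
  have "[int i = int j] (mod int n)"
    using act[of 0] by (auto simp: dihedral_act_nf split: if_splits)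
  then have ij: "i = j" using i(1) j(1) by (simp add: cong_int_iff cong_def)
  have "b = c"
  proof (rule ccontr)
    assume "b \<noteq> c"
    then have "int n dvd 2 \<or> int n dvd - 2"
      using act[of 1] ij by (auto simp: dihedral_act_nf cong_iff_dvd_diff split: if_splits)
    then have "int n dvd 2" by auto
    then have "int n \<le> 2" by (rule zdvd_imp_le) simp
    then show False using assms by simp
  qed
  with ij i(2) j(2) show "pres_eq (dihedral_rels n) u v"
    by (blast intro: pres_eq.sym pres_eq.trans)
qed (simp add: pres_eq_dihedral_act)

text \<open>\<open>rotation n a\<close> is y^a and \<open>reflection n a\<close> is y^a x. Exponents
  are arbitrary integers, so that sums and differences need no reduction.\<close>

definition rotation :: "nat \<Rightarrow> int \<Rightarrow> dihedral_gen word set" where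
  "rotation n a = pres_class (dihedral_rels n) (dihedral_nf (nat (a mod int n)) False)"

definition reflection :: "nat \<Rightarrow> int \<Rightarrow> dihedral_gen word set" where
  "reflection n a = pres_class (dihedral_rels n) (dihedral_nf (nat (a mod int n)) True)"

lemma rot_refl_carrier [simp]:
  "rotation n a \<in> carrier (dihedral_group n)" "reflection n a \<in> carrier (dihedral_group n)"
  by (simp_all add: rotation_def reflection_def dihedral_group_def presented_group_carrier)

lemma dihedral_cases:
  assumes "n \<ge> 3" "g \<in> carrier (dihedral_group n)"
  obtains a where "g = rotation n a" | a where "g = reflection n a"
proof -
  obtain i b where "i < n" "g = pres_class (dihedral_rels n) (dihedral_nf i b)"
    using dihedral_normal_form[of n g] assms by auto
  then have "g = (if b then reflection n (int i) else rotation n (int i))"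
    by (cases b) (simp_all add: rotation_def reflection_def flip: of_nat_mod)
  then show ?thesis using that by (cases b) simp_all
qed

abbreviation dprod :: "nat \<Rightarrow> dihedral_gen word set list \<Rightarrow> dihedral_gen word set" where
  "dprod n gs \<equiv> foldr (\<otimes>\<^bsub>dihedral_group n\<^esub>) gs \<one>\<^bsub>dihedral_group n\<^esub>"

context
  fixes n :: nat
  assumes n: "n \<ge> 3"
begin

lemma dihedral_act_nf_mod:
  "[dihedral_act (dihedral_nf (nat (a mod int n)) b) k = (if b then a - k else a + k)] (mod int n)"
proof -
  have "int (nat (a mod int n)) = a mod int n" using n by simp
  then show ?thesis
    unfolding dihedral_act_nf by (auto intro: cong_add cong_diff)
qed

lemma pres_class_dihedral_nf_mult:
  "pres_class (dihedral_rels n) (dihedral_nf (nat (a mod int n)) p) \<otimes>\<^bsub>dihedral_group n\<^esub>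
      pres_class (dihedral_rels n) (dihedral_nf (nat (b mod int n)) q)
    = pres_class (dihedral_rels n)
        (dihedral_nf (nat ((if p then a - b else a + b) mod int n)) (p \<noteq> q))"
  unfolding dihedral_group_def presented_group_mult pres_class_eq_iff
    pres_eq_dihedral_iff[OF n] dihedral_act_append
proof
  fix k
  let ?u = "dihedral_nf (nat (a mod int n)) p" and ?v = "dihedral_nf (nat (b mod int n)) q"
  let ?w = "dihedral_nf (nat ((if p then a - b else a + b) mod int n)) (p \<noteq> q)"
  have "[dihedral_act ?u (dihedral_act ?v k) = dihedral_act ?u (if q then b - k else b + k)] (mod int n)"
    by (intro dihedral_act_cong dihedral_act_nf_mod)
  also have "[dihedral_act ?u (if q then b - k else b + k) = dihedral_act ?w k] (mod int n)"
  proof -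
    have "(if p then a - (if q then b - k else b + k) else a + (if q then b - k else b + k))
        = (if p \<noteq> q then (if p then a - b else a + b) - k else (if p then a - b else a + b) + k)"
      by (cases p; cases q) auto
    from cong_trans[OF dihedral_act_nf_mod[of a p "if q then b - k else b + k", unfolded this]
          cong_sym[OF dihedral_act_nf_mod[of "if p then a - b else a + b" "p \<noteq> q" k]]]
    show ?thesis .
  qed
  finally show "[dihedral_act ?u (dihedral_act ?v k) = dihedral_act ?w k] (mod int n)" .
qed

lemma dihedral_mult:
  "rotation n a \<otimes>\<^bsub>dihedral_group n\<^esub> rotation n b = rotation n (a + b)"
  "rotation n a \<otimes>\<^bsub>dihedral_group n\<^esub> reflection n b = reflection n (a + b)"
  "reflection n a \<otimes>\<^bsub>dihedral_group n\<^esub> rotation n b = reflection n (a - b)"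
  "reflection n a \<otimes>\<^bsub>dihedral_group n\<^esub> reflection n b = rotation n (a - b)"
  using pres_class_dihedral_nf_mult[of a False b False] pres_class_dihedral_nf_mult[of a False b True]
    pres_class_dihedral_nf_mult[of a True b False] pres_class_dihedral_nf_mult[of a True b True]
  by (simp_all only: rotation_def reflection_def if_True if_False simp_thms)

lemma dihedral_one: "\<one>\<^bsub>dihedral_group n\<^esub> = rotation n 0"
  unfolding rotation_def dihedral_nf_def dihedral_group_def presented_group_one by simp

lemma rot_eq_iff: "rotation n a = rotation n b \<longleftrightarrow> [a = b] (mod int n)"
proof
  assume "rotation n a = rotation n b"
  then have "[dihedral_act (dihedral_nf (nat (a mod int n)) False) 0
      = dihedral_act (dihedral_nf (nat (b mod int n)) False) 0] (mod int n)"
    unfolding rotation_def pres_class_eq_iff by (rule pres_eq_dihedral_act)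
  then show "[a = b] (mod int n)"
    using dihedral_act_nf_mod[of a False 0] dihedral_act_nf_mod[of b False 0]
    by (simp add: cong_def)
next
  assume "[a = b] (mod int n)"
  then have "a mod int n = b mod int n" by (simp only: cong_def)
  then show "rotation n a = rotation n b" by (simp only: rotation_def)
qed

lemma rot_neq_refl: "rotation n a \<noteq> reflection n b"
proof
  assume "rotation n a = reflection n b"
  then have "pres_eq (dihedral_rels n) (dihedral_nf (nat (a mod int n)) False) (dihedral_nf (nat (b mod int n)) True)"
    by (simp add: rotation_def reflection_def pres_class_eq_iff)
  moreover have "nat (c mod int n) < n" for c
    using n by (simp add: nat_less_iff)
  ultimately show False using dihedral_nf_inj[OF n] by blast
qed

lemma dprod_carrier:
  assumes "set gs \<subseteq> carrier (dihedral_group n)"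
  shows "dprod n gs \<in> carrier (dihedral_group n)"
proof -
  interpret group "dihedral_group n" by (rule group_dihedral_group)
  show ?thesis using assms by (induction gs) simp_all
qed

lemma dprod_append:
  assumes "set gs \<subseteq> carrier (dihedral_group n)" "set hs \<subseteq> carrier (dihedral_group n)"
  shows "dprod n (gs @ hs) = dprod n gs \<otimes>\<^bsub>dihedral_group n\<^esub> dprod n hs"
  using assms(1)
proof (induction gs)
  interpret group "dihedral_group n" by (rule group_dihedral_group)
  {
    case Nil
    then show ?case using dprod_carrier[OF assms(2)] by simp
  next
    case (Cons g gs)
    then show ?case
      using dprod_carrier[OF assms(2)] dprod_carrier[of gs] by (simp add: m_assoc)
  }
qed

lemma dprod_rots: "dprod n (map (rotation n) as) = rotation n (sum_list as)"
  by (induction as) (simp_all only: list.map foldr.simps id_apply comp_apply sum_list.Nil sum_list.Cons dihedral_one dihedral_mult)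

end

section \<open>Signed sums of rotations and pairs of reflections\<close>

text \<open>An item is what enters a product with a sign of its own: a rotation, or two reflections,
  whose product y^b x y^c x is the rotation y^(b-c). Swapping the two reflections flips the
  sign.\<close>

datatype item = Rot int | Pr int int

primrec val :: "item \<Rightarrow> int" where
  "val (Rot a) = a"
| "val (Pr b c) = b - c"

primrec rots :: "item \<Rightarrow> int multiset" where
  "rots (Rot a) = {#a#}"
| "rots (Pr b c) = {#}"

primrec refs :: "item \<Rightarrow> int multiset" where
  "refs (Rot a) = {#}"
| "refs (Pr b c) = {#b, c#}"

abbreviation Val :: "item multiset \<Rightarrow> int" where "Val I \<equiv> \<Sum>i\<in>#I. val i"
abbreviation Rots :: "item multiset \<Rightarrow> int multiset" where "Rots I \<equiv> \<Sum>i\<in>#I. rots i"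
abbreviation Refs :: "item multiset \<Rightarrow> int multiset" where "Refs I \<equiv> \<Sum>i\<in>#I. refs i"

definition dseq :: "nat \<Rightarrow> int multiset \<Rightarrow> int multiset \<Rightarrow> dihedral_gen word set multiset" where
  "dseq n A B = image_mset (rotation n) A + image_mset (reflection n) B"

text \<open>No item may be left out: these are sign choices rather than subset sums, because a
  one-product sequence has to use up all its terms.\<close>

definition reach :: "int \<Rightarrow> item multiset \<Rightarrow> int \<Rightarrow> bool" where
  "reach k I v \<longleftrightarrow> (\<exists>I1 I2. I = I1 + I2 \<and> [Val I1 - Val I2 = v] (mod k))"

lemma dseq_carrier: "set_mset (dseq n A B) \<subseteq> carrier (dihedral_group n)"
  by (auto simp: dseq_def)

lemma size_dseq [simp]: "size (dseq n A B) = size A + size B"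
  by (simp add: dseq_def)

lemma dseq_mono: "A \<subseteq># A' \<Longrightarrow> B \<subseteq># B' \<Longrightarrow> dseq n A B \<subseteq># dseq n A' B'"
  by (simp add: dseq_def image_mset_subseteq_mono subset_mset.add_mono)

lemma dseq_exists:
  assumes "n \<ge> 3" "set_mset S \<subseteq> carrier (dihedral_group n)"
  obtains A B where "S = dseq n A B"
proof -
  from assms(2) have "\<exists>A B. S = dseq n A B"
  proof (induction S)
    case empty
    show ?case by (rule exI[of _ "{#}"], rule exI[of _ "{#}"]) (simp add: dseq_def)
  next
    case (add g S)
    then obtain A B where S: "S = dseq n A B" by auto
    have "g \<in> carrier (dihedral_group n)" using add.prems by simp
    then consider a where "g = rotation n a" | b where "g = reflection n b"
      using dihedral_cases[OF assms(1)] by blast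
    then show ?case
    proof cases
      case (1 a)
      then have "add_mset g S = dseq n (add_mset a A) B" by (simp add: S dseq_def)
      then show ?thesis by blast
    next
      case (2 b)
      then have "add_mset g S = dseq n A (add_mset b B)" by (simp add: S dseq_def)
      then show ?thesis by blast
    qed
  qed
  then show ?thesis using that by blast
qed

text \<open>Putting the two reflections of each pair side by side turns every item into a rotation,
  and rotations commute.\<close>

lemma items_arrangement:
  assumes "n \<ge> 3"
  shows "\<exists>gs. mset gs = dseq n (Rots I) (Refs I) \<and> dprod n gs = rotation n (Val I)"
proof (induction I)
  case empty
  show ?case by (rule exI[of _ "[]"]) (simp add: dseq_def dihedral_one[OF assms])
next
  case (add i I)
  then obtain gs where gs: "mset gs = dseq n (Rots I) (Refs I)" "dprod n gs = rotation n (Val I)" by blast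
  show ?case
  proof (cases i)
    case (Rot a)
    then show ?thesis
      using gs by (intro exI[of _ "rotation n a # gs"]) (simp add: dseq_def dihedral_mult[OF assms])
  next
    case (Pr b c)
    then show ?thesis
      using gs by (intro exI[of _ "reflection n b # reflection n c # gs"])
        (simp add: dseq_def dihedral_mult[OF assms] algebra_simps)
  qed
qed

lemma one_product_seq_rots:
  assumes "n \<ge> 3" "[sum_mset A = 0] (mod int n)"
  shows "one_product_seq (dihedral_group n) (dseq n A {#})"
proof -
  obtain as where as: "mset as = A" using ex_mset by blast
  have "dprod n (map (rotation n) as) = rotation n (sum_list as)"
    by (rule dprod_rots[OF assms(1)])
  also have "\<dots> = rotation n 0"
    using assms as rot_eq_iff[OF assms(1)] by (auto simp: sum_mset_sum_list)
  finally show ?thesis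
    unfolding one_product_seq_def using as
    by (intro exI[of _ "map (rotation n) as"]) (auto simp: dseq_def dihedral_one[OF assms(1)])
qed

text \<open>Rotations standing between two reflections are inverted; so a single pair of reflections
  makes both signs available to all other items.\<close>

lemma one_product_seq_items:
  assumes n: "n \<ge> 3" and "reach (int n) I 0" and "Pr b c \<in># I"
  shows "one_product_seq (dihedral_group n) (dseq n (Rots I) (Refs I))"
proof -
  obtain I1 I2 where I: "I = I1 + I2" "[Val I1 - Val I2 = 0] (mod int n)"
    using assms(2) by (auto simp: reach_def)
  \<comment> \<open>\<open>Refs\<close> does not record the order within a pair, so a pair counted
    negatively is handled as the swapped pair counted positively.\<close>
  have arrange: "one_product_seq (dihedral_group n) (dseq n (Rots I) (Refs I))"
    if "add_mset (Pr b c) (J1 + J2) = I \<or> add_mset (Pr c b) (J1 + J2) = I"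
      and v: "[b - c + Val J1 - Val J2 = 0] (mod int n)" for J1 J2 b c
  proof -
    obtain gs hs where gs: "mset gs = dseq n (Rots J1) (Refs J1)" "dprod n gs = rotation n (Val J1)"
      and hs: "mset hs = dseq n (Rots J2) (Refs J2)" "dprod n hs = rotation n (Val J2)"
      using items_arrangement[OF n] by metis
    have car: "set gs \<subseteq> carrier (dihedral_group n)" "set hs \<subseteq> carrier (dihedral_group n)"
      using gs(1) hs(1) dseq_carrier by (metis set_mset_mset)+
    let ?l = "reflection n b # hs @ reflection n c # gs"
    have "dprod n ?l = reflection n b \<otimes>\<^bsub>dihedral_group n\<^esub> (rotation n (Val J2)
        \<otimes>\<^bsub>dihedral_group n\<^esub> (reflection n c \<otimes>\<^bsub>dihedral_group n\<^esub> rotation n (Val J1)))"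
      using dprod_append[OF n car(2), of "reflection n c # gs"] car(1) gs hs by simp
    also have "\<dots> = rotation n (b - c + Val J1 - Val J2)"
      by (simp add: dihedral_mult[OF n] algebra_simps)
    also have "\<dots> = rotation n 0" using v rot_eq_iff[OF n] by blast
    finally have "dprod n ?l = \<one>\<^bsub>dihedral_group n\<^esub>" by (simp add: dihedral_one[OF n])
    moreover have "mset ?l = dseq n (Rots I) (Refs I)"
      using that(1) gs(1) hs(1) by (auto simp: dseq_def)
    ultimately show ?thesis unfolding one_product_seq_def by blast
  qed
  consider "Pr b c \<in># I1" | "Pr b c \<in># I2" using assms(3) I(1) by auto
  then show ?thesis
  proof cases
    case 1
    then obtain J where J: "I1 = add_mset (Pr b c) J" by (meson multi_member_split)
    show ?thesis
      by (rule arrange[of b c J I2]) (use I J in auto)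
  next
    case 2
    then obtain J where J: "I2 = add_mset (Pr b c) J" by (meson multi_member_split)
    show ?thesis
      by (rule arrange[of c b I1 J]) (use I J in \<open>auto simp: algebra_simps\<close>)
  qed
qed

section \<open>Subset sums filling a subgroup\<close>

definition subset_sums :: "nat \<Rightarrow> int multiset \<Rightarrow> int set" where
  "subset_sums q G = (\<lambda>I. sum_mset I mod int q) ` {I. I \<subseteq># G}"

lemma subset_sums_range: "q > 0 \<Longrightarrow> subset_sums q G \<subseteq> {0..<int q}"
  by (auto simp: subset_sums_def)

lemma finite_subset_sums: "q > 0 \<Longrightarrow> finite (subset_sums q G)"
  by (rule finite_subset[OF subset_sums_range]) auto

lemma subset_sums_mono: "G \<subseteq># G' \<Longrightarrow> subset_sums q G \<subseteq> subset_sums q G'"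
  by (auto simp: subset_sums_def intro: subset_mset.order_trans)

lemma subset_sums_shift:
  assumes "x \<in> subset_sums q G"
  shows "(x + g) mod int q \<in> subset_sums q (add_mset g G)"
proof -
  obtain I where I: "I \<subseteq># G" "x = sum_mset I mod int q" using assms by (auto simp: subset_sums_def)
  have "(x + g) mod int q = sum_mset (add_mset g I) mod int q"
    unfolding I(2) by (simp add: mod_simps add.commute)
  then show ?thesis using I(1) unfolding subset_sums_def by (intro image_eqI[of _ _ "add_mset g I"]) auto
qed

text \<open>A largest sub-multiset \<open>I\<close> with at least \<open>|I| + 1\<close> subset sums either
  attains every residue, or all remaining terms stabilise the set of its subset sums. That set then
  misses a coset of the stabiliser, so enough terms remain to recurse into the stabiliser.\<close>

lemma subset_sums_fill_subgroup:
  fixes q :: nat and G :: "int multiset"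
  assumes "q \<ge> 2" "\<forall>g\<in>#G. \<not> int q dvd g" "size G + 1 \<ge> q"
  shows "\<exists>q' I. q' dvd q \<and> q' < q \<and> I \<subseteq># G \<and> (\<forall>g\<in>#I. int q' dvd g) \<and> size I + 1 \<le> q div q' \<and>
    (\<forall>v. int q' dvd v \<longrightarrow> (\<exists>J. J \<subseteq># I \<and> [sum_mset J = v] (mod int q)))"
  using assms
proof (induction q arbitrary: G rule: less_induct)
  case (less q)
  have q0: "q > 0" using less.prems by simp
  define grows where "grows I \<longleftrightarrow> I \<subseteq># G \<and> size I + 1 \<le> card (subset_sums q I)" for I
  have "grows {#}" by (simp add: grows_def subset_sums_def)
  moreover have "\<forall>I. grows I \<longrightarrow> size I \<le> size G" by (auto simp: grows_def size_mset_mono)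
  ultimately obtain I where I: "grows I" and Imax: "\<And>J. grows J \<Longrightarrow> size J \<le> size I"
    using ex_has_greatest_nat[of grows "{#}" size "Suc (size G)"] by (auto simp: less_Suc_eq_le)
  define X where "X = subset_sums q I"
  have IG: "I \<subseteq># G" and Icard: "size I + 1 \<le> card X" using I by (auto simp: grows_def X_def)
  have Xsub: "X \<subseteq> {0..<int q}" and Xfin: "finite X"
    using q0 by (auto simp: X_def intro: finite_subset_sums dest: subset_sums_range[THEN subsetD])
  have Xne: "X \<noteq> {}" using Icard by auto
  show ?case
  proof (cases "X = {0..<int q}")
    case True
    have "\<exists>J. J \<subseteq># I \<and> [sum_mset J = v] (mod int q)" for v
    proof -
      have "v mod int q \<in> X" using True q0 by simp
      then show ?thesis by (auto simp: X_def subset_sums_def cong_def)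
    qed
    moreover have "size I + 1 \<le> q" using Icard True by simp
    ultimately show ?thesis using IG less.prems(1) by (intro exI[of _ 1] exI[of _ I]) auto
  next
    case False
    \<comment> \<open>\<open>P t\<close> says that \<open>t\<close> stabilises \<open>X\<close>.
      Maximality of \<open>I\<close> puts all remaining terms into the stabiliser.\<close>
    define P where "P t \<longleftrightarrow> (\<forall>x\<in>X. (x + t) mod int q \<in> X)" for t
    have P_rest: "P g" if g: "g \<in># G - I" for g
    proof -
      obtain H where "G - I = add_mset g H" using g by (meson multi_member_split)
      then have "G = add_mset g I + H" using IG by (metis subset_mset.add_diff_inverse union_mset_add_mset_left union_mset_add_mset_right)
      then have sub: "add_mset g I \<subseteq># G" by simp
      have "card (subset_sums q (add_mset g I)) \<le> card X"
      proof (rule ccontr)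
        assume "\<not> ?thesis"
        then have "size (add_mset g I) \<le> size I"
          using Imax[of "add_mset g I"] sub Icard
          by (simp add: grows_def)
        then show False by simp
      qed
      moreover have "X \<subseteq> subset_sums q (add_mset g I)"
        unfolding X_def by (rule subset_sums_mono) simp
      ultimately have "X = subset_sums q (add_mset g I)"
        using card_seteq[OF finite_subset_sums[OF q0]] by blast
      then show ?thesis unfolding P_def using subset_sums_shift[of _ q I g] by (auto simp: X_def)
    qed
    have P_add: "P (s + t)" if "P s" "P t" for s t
      using that unfolding P_def by (metis add.assoc mod_add_left_eq)
    have P_cong: "P s" if "P t" "[t = s] (mod int q)" for s t
      using that unfolding P_def by (metis cong_def mod_add_right_eq)
    have P_0: "P 0" using Xsub unfolding P_def by (auto simp: mod_pos_pos_trivial)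
    have P_mult: "P (c * t)" if "P t" for c t
    proof -
      have nat: "P (int i * t)" for i
        by (induction i) (auto simp: P_0 distrib_right intro: P_add that)
      have "[int (nat (c mod int q)) * t = c * t] (mod int q)"
        using q0 by (intro cong_mult cong_refl) simp
      then show ?thesis using P_cong[OF nat] by blast
    qed
    \<comment> \<open>The stabiliser is a subgroup, generated by its least positive element.\<close>
    define j where "j = (LEAST t. t > 0 \<and> P (int t))"
    have "P (int q)" using P_cong[OF P_0, of "int q"] by (simp add: cong_def)
    then have j: "j > 0 \<and> P (int j)" unfolding j_def using LeastI[of "\<lambda>t. t > 0 \<and> P (int t)" q] q0 by simp
    have j_dvd: "int j dvd s" if "P s" for s
    proof (rule ccontr)
      assume nd: "\<not> int j dvd s"
      have "P (s + - (s div int j) * int j)" using P_add[OF that P_mult] j by blast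
      moreover have "s + - (s div int j) * int j = s mod int j"
        using minus_div_mult_eq_mod[of s "int j"] by simp
      ultimately have "P (s mod int j)" by simp
      moreover have lt: "s mod int j < int j" using j by simp
      moreover have "s mod int j > 0"
      proof -
        have "s mod int j \<ge> 0" using j by simp
        moreover have "s mod int j \<noteq> 0" using nd by (simp add: dvd_eq_mod_eq_0)
        ultimately show ?thesis by linarith
      qed
      ultimately have "nat (s mod int j) > 0 \<and> P (int (nat (s mod int j)))" "nat (s mod int j) < j"
        by auto
      then show False using not_less_Least[of _ "\<lambda>t. t > 0 \<and> P (int t)"] unfolding j_def by blast
    qed
    have jq: "j dvd q" using j_dvd[OF \<open>P (int q)\<close>] by simp
    then obtain q1 where q1: "q = j * q1" by blast
    have q1_0: "q1 > 0" using q1 q0 by simp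
    have cX: "card X < q"
      using psubset_card_mono[of "{0..<int q}" X] False Xsub by simp
    have szI: "size I + 2 \<le> q" using cX Icard by simp
    have "G = I + (G - I)" using IG by simp
    then have szG: "size G = size I + size (G - I)" by (metis size_union)
    then have "G - I \<noteq> {#}" using szI less.prems(3) by auto
    then obtain g0 where g0: "g0 \<in># G - I" by blast
    have "j \<noteq> q"
      using j_dvd[OF P_rest[OF g0]] less.prems(2) g0 by (metis in_diffD)
    then have q1_2: "q1 \<ge> 2" using q1 q1_0 by (cases q1; cases "q1 - 1") auto
    obtain y where y: "y \<in> {0..<int q}" "y \<notin> X" using False Xsub by blast
    have j2: "j \<ge> 2"
    proof (rule ccontr)
      assume "\<not> j \<ge> 2"
      then have "P 1" using j by (cases "j = 1") auto
      obtain x where "x \<in> X" using Xne by blast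
      have "P (y - x)" using P_mult[OF \<open>P 1\<close>, of "y - x"] by simp
      then have "y mod int q \<in> X" using \<open>x \<in> X\<close> unfolding P_def by force
      then show False using y by simp
    qed
    \<comment> \<open>Together with \<open>y\<close>, its whole coset of the stabiliser is missed by
      \<open>X\<close>, which makes \<open>q1\<close> residues. As \<open>I\<close> has fewer terms
      than \<open>X\<close> has elements, at least \<open>q1\<close> terms of \<open>G\<close>
      remain.\<close>
    have miss: "(y + int i * int j) mod int q \<in> {0..<int q} - X" for i
    proof -
      have "(y + int i * int j) mod int q \<notin> X"
      proof
        assume "(y + int i * int j) mod int q \<in> X"
        moreover have "P (- int i * int j)" using j by (intro P_mult) simp
        ultimately have "((y + int i * int j) mod int q + - int i * int j) mod int q \<in> X"
          unfolding P_def by blast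
        then have "y mod int q \<in> X" by (simp add: mod_simps)
        then show False using y by simp
      qed
      then show ?thesis using q0 by simp
    qed
    have "inj_on (\<lambda>i. (y + int i * int j) mod int q) {..<q1}"
    proof (rule inj_onI)
      fix a b assume ab: "a \<in> {..<q1}" "b \<in> {..<q1}"
        "(y + int a * int j) mod int q = (y + int b * int j) mod int q"
      then have "[int a * int j = int b * int j] (mod int q)"
        by (simp add: cong_add_lcancel flip: cong_def)
      then have "[int j * int a = int j * int b] (mod int j * int q1)"
        by (simp add: q1 mult.commute)
      then have "[int a = int b] (mod int q1)" using j by (simp add: cong_iff_dvd_diff flip: right_diff_distrib)
      then show "a = b" using ab by (simp add: cong_int_iff cong_def)
    qed
    then have "q1 \<le> card ({0..<int q} - X)"
      using card_inj_on_le[OF _ image_subsetI[OF miss]] by fastforce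
    also have "\<dots> = q - card X" using card_Diff_subset[OF Xfin Xsub] by simp
    finally have "size (G - I) \<ge> q1" using Icard szG less.prems(3) cX by linarith
    \<comment> \<open>The remaining terms are multiples of \<open>j\<close>; division by
      \<open>j\<close> gives an instance modulo \<open>q1\<close>, whose solution is multiplied by
      \<open>j\<close> again at the end.\<close>
    define G' where "G' = image_mset (\<lambda>g. g div int j) (G - I)"
    have "q1 < q" using q1 j2 q1_0 by simp
    moreover have "\<forall>g\<in>#G'. \<not> int q1 dvd g"
    proof
      fix g assume "g \<in># G'"
      then obtain h where h: "h \<in># G - I" "g = h div int j" by (auto simp: G'_def)
      have "h = int j * g" using j_dvd[OF P_rest[OF h(1)]] h(2) by simp
      moreover have "\<not> int q dvd h" using less.prems(2) h(1) by (metis in_diffD)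
      ultimately show "\<not> int q1 dvd g" using q1 by simp
    qed
    moreover have "size G' + 1 \<ge> q1" using \<open>size (G - I) \<ge> q1\<close> by (simp add: G'_def)
    ultimately obtain q'' I'' where IH: "q'' dvd q1" "q'' < q1" "I'' \<subseteq># G'" "\<forall>g\<in>#I''. int q'' dvd g"
      "size I'' + 1 \<le> q1 div q''"
      "\<And>v. int q'' dvd v \<Longrightarrow> \<exists>J. J \<subseteq># I'' \<and> [sum_mset J = v] (mod int q1)"
      using less.IH[of q1 G'] q1_2 by metis
    have "image_mset ((*) (int j)) I'' \<subseteq># image_mset ((*) (int j)) G'"
      by (rule image_mset_subseteq_mono[OF IH(3)])
    also have "\<dots> = image_mset (\<lambda>g. g) (G - I)"
      unfolding G'_def image_mset.compositionality
      by (rule image_mset_cong) (simp add: j_dvd P_rest)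
    also have "\<dots> \<subseteq># G" by simp
    finally have sub: "image_mset ((*) (int j)) I'' \<subseteq># G" .
    have fill: "\<exists>J. J \<subseteq># image_mset ((*) (int j)) I'' \<and> [sum_mset J = v] (mod int q)"
      if v: "int (j * q'') dvd v" for v
    proof -
      obtain w where w: "v = int j * (int q'' * w)" using v by (metis dvdE mult.assoc of_nat_mult)
      obtain J where J: "J \<subseteq># I''" "[sum_mset J = int q'' * w] (mod int q1)"
        using IH(6)[of "int q'' * w"] by auto
      have "sum_mset (image_mset ((*) (int j)) J) = int j * sum_mset J"
        by (induction J) (simp_all add: distrib_left)
      moreover have "[int j * sum_mset J = v] (mod int q)"
        unfolding w q1 using J(2) by (simp add: cong_iff_dvd_diff flip: right_diff_distrib)
      ultimately show ?thesis using image_mset_subseteq_mono[OF J(1)] by metis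
    qed
    show ?thesis
    proof (rule exI[of _ "j * q''"], rule exI[of _ "image_mset ((*) (int j)) I''"],
        intro conjI allI impI)
      show "j * q'' dvd q" "j * q'' < q" using IH(1,2) q1 j by auto
      show "size (image_mset ((*) (int j)) I'') + 1 \<le> q div (j * q'')"
        using IH(5) j by (simp add: q1)
    qed (use sub fill IH(4) in auto)
  qed
qed

section \<open>Pairing reflections\<close>

lemma sub_image_mset:
  assumes "M \<subseteq># image_mset f N"
  obtains K where "K \<subseteq># N" "M = image_mset f K"
proof -
  obtain C where "image_mset f N = M + C" using assms by (auto simp: mset_subset_eq_exists_conv)
  then obtain K L where "N = K + L" "M = image_mset f K" by (auto dest: image_mset_eq_plusD)
  then show ?thesis using that[of K] by simp
qed

lemma ex_sub_mset_size:
  assumes "t \<le> size M"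
  obtains N where "N \<subseteq># M" "size N = t"
proof -
  obtain xs where xs: "M = mset xs" by (metis ex_mset)
  show ?thesis
  proof (rule that[of "mset (take t xs)"])
    show "mset (take t xs) \<subseteq># M"
      unfolding xs by (metis append_take_drop_id mset_append mset_subset_eq_add_left)
  qed (use assms xs in simp)
qed

text \<open>Meant for pairs; the value at \<open>Rot\<close> is a default that makes the function
  total, and likewise for \<open>snd_ref\<close>.\<close>

primrec fst_ref :: "item \<Rightarrow> int" where
  "fst_ref (Rot a) = a"
| "fst_ref (Pr b c) = b"

primrec snd_ref :: "item \<Rightarrow> int" where
  "snd_ref (Rot a) = a"
| "snd_ref (Pr b c) = c"

primrec is_Pr :: "item \<Rightarrow> bool" where
  "is_Pr (Rot a) = False"
| "is_Pr (Pr b c) = True"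

lemma is_PrE: "is_Pr i \<Longrightarrow> (\<And>b c. i = Pr b c \<Longrightarrow> P) \<Longrightarrow> P"
  by (cases i) auto

lemma Refs_Pr: "\<forall>i\<in>#J. is_Pr i \<Longrightarrow> Refs J = image_mset fst_ref J + image_mset snd_ref J"
  by (induction J) (auto elim!: is_PrE)

lemma Rots_Pr: "\<forall>i\<in>#J. is_Pr i \<Longrightarrow> Rots J = {#}"
  by (induction J) (auto elim!: is_PrE)

lemma Val_Pr: "\<forall>i\<in>#J. is_Pr i \<Longrightarrow> Val J = sum_mset (image_mset fst_ref J) - sum_mset (image_mset snd_ref J)"
  by (induction J) (auto elim!: is_PrE)

lemma size_Refs_Pr: "\<forall>i\<in>#J. is_Pr i \<Longrightarrow> size (Refs J) = 2 * size J"
  by (simp add: Refs_Pr)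

lemma Rots_mono: "I \<subseteq># J \<Longrightarrow> Rots I \<subseteq># Rots J"
  by (auto simp: mset_subset_eq_exists_conv)

lemma Refs_mono: "I \<subseteq># J \<Longrightarrow> Refs I \<subseteq># Refs J"
  by (auto simp: mset_subset_eq_exists_conv)

lemma zip_items:
  assumes "size X \<le> size Z"
  obtains J where "\<forall>i\<in>#J. is_Pr i" "image_mset fst_ref J = X" "image_mset snd_ref J \<subseteq># Z"
proof -
  from assms have "\<exists>J. (\<forall>i\<in>#J. is_Pr i) \<and> image_mset fst_ref J = X \<and> image_mset snd_ref J \<subseteq># Z"
  proof (induction X arbitrary: Z)
    case (add x X)
    then obtain z Z' where Z: "Z = add_mset z Z'" by (cases Z) auto
    then obtain J where "\<forall>i\<in>#J. is_Pr i" "image_mset fst_ref J = X" "image_mset snd_ref J \<subseteq># Z'"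
      using add.IH[of Z'] add.prems by auto
    then show ?case by (intro exI[of _ "add_mset (Pr x z) J"]) (auto simp: Z)
  qed auto
  then show ?thesis using that by blast
qed

lemma pair_items:
  assumes "2 * t \<le> size B"
  obtains J where "\<forall>i\<in>#J. is_Pr i" "size J = t" "Refs J \<subseteq># B"
proof -
  obtain X where X: "X \<subseteq># B" "size X = t" using ex_sub_mset_size[of t B] assms by auto
  then have "size X \<le> size (B - X)" using assms by (simp add: size_Diff_submset)
  from zip_items[OF this] obtain J
    where J: "\<forall>i\<in>#J. is_Pr i" "image_mset fst_ref J = X" "image_mset snd_ref J \<subseteq># B - X" by blast
  then have "Refs J \<subseteq># B"
    using X(1) by (simp add: Refs_Pr subset_mset.le_diff_conv2 add.commute)
  moreover have "size J = t" using J(2) X(2) by (metis size_image_mset)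
  ultimately show ?thesis using that J(1) by blast
qed

section \<open>Pairs of congruent and of incongruent reflections\<close>

lemma mset_pigeonhole:
  fixes B :: "int multiset"
  assumes "k > 0" "size B > k"
  shows "\<exists>b c. {#b, c#} \<subseteq># B \<and> [b = c] (mod int k)"
proof -
  define R where "R = image_mset (\<lambda>b. b mod int k) B"
  have "\<exists>r. count R r \<ge> 2"
  proof (rule ccontr)
    assume "\<not> ?thesis"
    then have "count R r \<le> 1" for r by (auto simp: not_le numeral_2_eq_2 less_Suc_eq_le)
    then have "size R \<le> (\<Sum>r\<in>set_mset R. 1)"
      unfolding size_multiset_overloaded_eq by (rule sum_mono)
    also have "\<dots> \<le> card {0..<int k}"
    proof -
      have "set_mset R \<subseteq> {0..<int k}" using assms(1) by (auto simp: R_def)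
      then show ?thesis using card_mono[of "{0..<int k}" "set_mset R"] by simp
    qed
    finally show False using assms by (simp add: R_def)
  qed
  then obtain r where "count R r \<ge> 2" by blast
  moreover have "count R r = size (filter_mset (\<lambda>b. b mod int k = r) B)"
    unfolding R_def by (induction B) auto
  ultimately have "size (filter_mset (\<lambda>b. b mod int k = r) B) \<ge> 2" by simp
  then obtain b B' where b: "filter_mset (\<lambda>b. b mod int k = r) B = add_mset b B'" "size B' \<ge> 1"
    by (cases "filter_mset (\<lambda>b. b mod int k = r) B") auto
  then obtain c B'' where c: "B' = add_mset c B''" by (cases B') auto
  have bc: "{#b, c#} \<subseteq># filter_mset (\<lambda>b. b mod int k = r) B" using b c by simp
  then have "b \<in># filter_mset (\<lambda>b. b mod int k = r) B" "c \<in># filter_mset (\<lambda>b. b mod int k = r) B"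
    by (auto dest: mset_subset_eqD)
  then have "[b = c] (mod int k)" by (simp add: cong_def)
  moreover have "{#b, c#} \<subseteq># B"
    using bc multiset_filter_subset by (rule subset_mset.order_trans)
  ultimately show ?thesis by blast
qed

text \<open>While more than \<open>k\<close> reflections are left, two of them are congruent modulo
  \<open>k\<close>. The bound leaves at least \<open>k + 1\<close> of them for the choice of the
  last pair.\<close>

lemma equal_pair_items:
  assumes "k > 0" "2 * c + k \<le> size B + 1"
  shows "\<exists>J. (\<forall>i\<in>#J. is_Pr i \<and> int k dvd val i) \<and> size J = c \<and> Refs J \<subseteq># B"
  using assms(2)
proof (induction c arbitrary: B)
  case 0
  show ?case by (rule exI[of _ "{#}"]) simp
next
  case (Suc c)
  obtain x y where "{#x, y#} \<subseteq># B" and xy: "[x = y] (mod int k)"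
    using mset_pigeonhole[OF assms(1), of B] Suc.prems by auto
  then obtain B' where B: "B = {#x, y#} + B'" by (auto simp: mset_subset_eq_exists_conv)
  then have "2 * c + k \<le> size B' + 1" using Suc.prems by simp
  from Suc.IH[OF this] obtain J
    where J: "\<forall>i\<in>#J. is_Pr i \<and> int k dvd val i" "size J = c" "Refs J \<subseteq># B'" by blast
  have "Refs (add_mset (Pr x y) J) \<subseteq># B" using J(3) by (simp add: B)
  then show ?case
    using J xy by (intro exI[of _ "add_mset (Pr x y) J"]) (auto simp: cong_iff_dvd_diff)
qed

text \<open>Sort by residue and pair each element with the one half the length further on: if they agree
  modulo \<open>k\<close>, then so do all elements between, and their class contains half of all elements.\<close>

lemma unequal_pair_items:
  fixes B :: "int multiset"
  assumes "k > 0"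
  shows "(\<exists>c. size {#b \<in># B. b mod int k \<noteq> c#} \<le> size {#b \<in># B. b mod int k = c#}) \<or>
    (\<exists>J. (\<forall>i\<in>#J. is_Pr i \<and> \<not> int k dvd val i) \<and> size J = size B div 2 \<and> Refs J \<subseteq># B)"
proof -
  obtain ys where ys: "mset ys = B" using ex_mset by blast
  define f where "f = (\<lambda>b. b mod int k)"
  define xs where "xs = sort_key f ys"
  have xs: "mset xs = B" "sorted (map f xs)" by (simp_all add: xs_def ys)
  define t where "t = length xs div 2"
  show ?thesis
  proof (cases "\<exists>i<t. f (xs ! i) = f (xs ! (i + t))")
    case True
    then obtain i where i: "i < t" "f (xs ! i) = f (xs ! (i + t))" by blast
    define c where "c = f (xs ! i)"
    have it: "i + t < length xs" using i(1) by (simp add: t_def)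
    \<comment> \<open>In a sorted list a window of \<open>t + 1\<close> consecutive entries with
      equal ends is constant, and at most \<open>t\<close> entries lie outside it since the length
      is at most \<open>2 * t + 1\<close>.\<close>
    define zs where "zs = take (t + 1) (drop i xs)"
    have "f z = c" if z: "z \<in> set zs" for z
    proof -
      obtain l where l: "l < length zs" "z = zs ! l"
        using z by (auto simp: in_set_conv_nth)
      have lz: "l \<le> t" "z = xs ! (i + l)" using l it by (simp_all add: zs_def)
      have "map f xs ! i \<le> map f xs ! (i + l)" "map f xs ! (i + l) \<le> map f xs ! (i + t)"
        using lz it by (intro sorted_nth_mono[OF xs(2)]; simp)+
      then show ?thesis using i(2) lz it by (simp add: c_def)
    qed
    then have "filter_mset (\<lambda>b. f b = c) (mset zs) = mset zs"
      by (simp add: filter_mset_eq_conv)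
    moreover have "mset zs \<subseteq># B"
    proof -
      have "xs = take i xs @ zs @ drop (t + 1) (drop i xs)"
        unfolding zs_def by (metis append_take_drop_id)
      then have "B = mset (take i xs) + (mset zs + mset (drop (t + 1) (drop i xs)))"
        using xs(1) by (metis mset_append)
      then show ?thesis by (metis mset_subset_eq_add_left mset_subset_eq_add_right subset_mset.order_trans)
    qed
    ultimately have "mset zs \<subseteq># filter_mset (\<lambda>b. f b = c) B"
      by (metis multiset_filter_mono)
    then have "t + 1 \<le> size (filter_mset (\<lambda>b. f b = c) B)"
      using size_mset_mono[of "mset zs"] it by (simp add: zs_def)
    moreover have "size B = size (filter_mset (\<lambda>b. f b = c) B) + size (filter_mset (\<lambda>b. f b \<noteq> c) B)"
      by (metis multiset_partition size_union)
    moreover have "size B = length xs" using xs(1) by (metis size_mset)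
    ultimately have "size (filter_mset (\<lambda>b. f b \<noteq> c) B) \<le> size (filter_mset (\<lambda>b. f b = c) B)"
      unfolding t_def by linarith
    then show ?thesis unfolding f_def by blast
  next
    case False
    define J where "J = mset (map2 Pr (take t xs) (take t (drop t xs)))"
    have len: "length (take t xs) = t" "length (take t (drop t xs)) = t" by (simp_all add: t_def)
    have Jpr: "\<forall>i\<in>#J. is_Pr i" by (auto simp: J_def)
    have "image_mset fst_ref J = mset (take t xs)" "image_mset snd_ref J = mset (take t (drop t xs))"
    proof -
      have "map fst_ref (map2 Pr us vs) = us" "map snd_ref (map2 Pr us vs) = vs"
        if "length us = length vs" for us vs
        using that by (induction us vs rule: list_induct2) auto
      then show "image_mset fst_ref J = mset (take t xs)" "image_mset snd_ref J = mset (take t (drop t xs))"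
        using len by (simp_all add: J_def flip: mset_map)
    qed
    then have "Refs J = mset (take t xs @ take t (drop t xs))" using Jpr by (simp add: Refs_Pr)
    moreover have "B = mset (take t xs @ take t (drop t xs)) + mset (drop t (drop t xs))"
      using xs(1) by (metis append_take_drop_id mset_append append_assoc)
    ultimately have "Refs J \<subseteq># B" by simp
    moreover have "\<not> int k dvd val i" if "i \<in># J" for i
    proof -
      from that obtain l where l: "l < t" "i = Pr (xs ! l) (xs ! (l + t))"
        using len by (auto simp: J_def in_set_conv_nth add.commute)
      then show ?thesis using False by (auto simp: f_def mod_eq_dvd_iff)
    qed
    moreover have "size J = size B div 2" using len xs(1) by (auto simp: J_def t_def)
    ultimately show ?thesis using Jpr by blast
  qed
qed

text \<open>Two of the \<open>2 ^ t\<close> selections from \<open>t\<close> items have the same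
  value modulo \<open>k\<close>. Without their common part, one taken positively and the other
  negatively, they form a signed zero sum.\<close>

lemma signed_pigeonhole:
  fixes k :: nat
  assumes "0 < k" "k < 2 ^ t" "t \<le> size I"
  shows "\<exists>V. V \<subseteq># I \<and> V \<noteq> {#} \<and> size V \<le> t \<and> reach (int k) V 0"
proof -
  obtain I' where I': "I' \<subseteq># I" "size I' = t" using ex_sub_mset_size[OF assms(3)] by blast
  obtain xs where xs: "mset xs = I'" using ex_mset by blast
  have lx: "length xs = t" using xs I'(2) by auto
  \<comment> \<open>Selections are sets of positions, since repeated items would leave fewer than
    \<open>2 ^ t\<close> sub-multisets.\<close>
  define M where "M P = image_mset ((!) xs) (mset_set P)" for P
  have Mfull: "M {..<t} = I'"
    unfolding M_def using xs lx by (metis lessThan_atLeast0 map_nth mset_map mset_upt)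
  have MU: "M (P \<union> Q) = M P + M Q" if "finite P" "finite Q" "P \<inter> Q = {}" for P Q
    unfolding M_def by (simp add: mset_set_Union that)
  define g where "g P = Val (M P) mod int k" for P
  have "g ` Pow {..<t} \<subseteq> {0..<int k}" using assms(1) by (auto simp: g_def)
  then have "card (g ` Pow {..<t}) \<le> k" using card_mono[of "{0..<int k}"] by fastforce
  also have "k < card (Pow {..<t})" using assms(2) by (simp add: card_Pow)
  finally have "\<not> inj_on g (Pow {..<t})" by (rule pigeonhole)
  then obtain P Q where PQ: "P \<subseteq> {..<t}" "Q \<subseteq> {..<t}" "P \<noteq> Q" "g P = g Q"
    by (auto simp: inj_on_def)
  have fin: "finite P" "finite Q" using PQ finite_subset by blast+
  let ?V = "M (P - Q) + M (Q - P)"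
  have V: "?V = M ((P - Q) \<union> (Q - P))" using fin by (subst MU) auto
  have "{..<t} = ((P - Q) \<union> (Q - P)) \<union> ({..<t} - ((P - Q) \<union> (Q - P)))" using PQ by auto
  then have "I' = ?V + M ({..<t} - ((P - Q) \<union> (Q - P)))"
    unfolding V Mfull[symmetric] using fin by (subst MU[symmetric]) auto
  then have sub: "?V \<subseteq># I'" by (metis mset_subset_eq_add_left)
  have "?V \<noteq> {#}" using PQ(3) fin by (auto simp: M_def mset_set_empty_iff)
  moreover have "reach (int k) ?V 0"
  proof -
    have "(P - Q) \<union> (P \<inter> Q) = P" "(Q - P) \<union> (P \<inter> Q) = Q"
      "(P - Q) \<inter> (P \<inter> Q) = {}" "(Q - P) \<inter> (P \<inter> Q) = {}" by blast+
    then have "M P = M (P - Q) + M (P \<inter> Q)" "M Q = M (Q - P) + M (P \<inter> Q)"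
      using MU[of "P - Q" "P \<inter> Q"] MU[of "Q - P" "P \<inter> Q"] fin by simp_all
    then have "Val (M P) - Val (M Q) = Val (M (P - Q)) - Val (M (Q - P))" by simp
    moreover have "[Val (M P) - Val (M Q) = 0] (mod int k)"
      using PQ(4) by (simp add: g_def cong_iff_dvd_diff mod_eq_dvd_iff)
    ultimately show ?thesis unfolding reach_def by auto
  qed
  moreover have "?V \<subseteq># I" using sub I'(1) by (rule subset_mset.order_trans)
  moreover have "size ?V \<le> t" using size_mset_mono[OF sub] I'(2) by simp
  ultimately show ?thesis by blast
qed

section \<open>The Erdos-Ginzburg-Ziv theorem\<close>

lemma dvd_sum_mset: "(\<And>x. x \<in># M \<Longrightarrow> d dvd f x) \<Longrightarrow> d dvd (\<Sum>x\<in>#M. f x)"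
  for f :: "'a \<Rightarrow> int"
  by (induction M) auto

text \<open>Of \<open>2 * p - 1\<close> terms either \<open>p\<close> are congruent, or all but one
  split into \<open>p - 1\<close> incongruent pairs. One entry is taken from each pair; the choices
  change the sum by subset sums of the differences, which fill all residues.\<close>

lemma egz_prime:
  fixes G :: "int multiset"
  assumes p: "prime p" and size: "size G + 1 \<ge> 2 * p"
  shows "\<exists>T. T \<subseteq># G \<and> size T = p \<and> int p dvd sum_mset T"
proof -
  have p2: "p \<ge> 2" using p by (rule prime_ge_2_nat)
  have "2 * p - 1 \<le> size G" using size by arith
  then obtain H where H: "H \<subseteq># G" "size H = 2 * p - 1" using ex_sub_mset_size by blast
  consider (maj) c where "size {#b \<in># H. b mod int p \<noteq> c#} \<le> size {#b \<in># H. b mod int p = c#}"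
    | (pairs) J where "\<forall>i\<in>#J. is_Pr i \<and> \<not> int p dvd val i" "size J = size H div 2" "Refs J \<subseteq># H"
    using unequal_pair_items[of p H] p2 by auto
  then show ?thesis
  proof cases
    case maj
    have "size H = size {#b \<in># H. b mod int p = c#} + size {#b \<in># H. b mod int p \<noteq> c#}"
      by (metis multiset_partition size_union)
    then have "p \<le> size {#b \<in># H. b mod int p = c#}" using maj H(2) p2 by linarith
    then obtain T where T: "T \<subseteq># {#b \<in># H. b mod int p = c#}" "size T = p"
      using ex_sub_mset_size by blast
    have "[sum_mset T = int (size T) * c] (mod int p)"
    proof -
      have "\<forall>b\<in>#T. b mod int p = c" using T(1) by (auto dest: mset_subset_eqD)
      then show ?thesis
      proof (induction T)
        case (add x T)
        then have "[x = c] (mod int p)" by (auto simp: cong_def)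
        then have "[x + sum_mset T = c + int (size T) * c] (mod int p)"
          using add by (intro cong_add) auto
        then show ?case by (simp add: algebra_simps)
      qed simp
    qed
    then have "int p dvd sum_mset T" by (simp add: T(2) cong_dvd_iff)
    moreover have "T \<subseteq># G"
      by (rule subset_mset.order_trans[OF subset_mset.order_trans[OF T(1) multiset_filter_subset] H(1)])
    ultimately show ?thesis using T(2) by blast
  next
    case pairs
    have sJ: "size J = p - 1" using pairs(2) H(2) by linarith
    have "\<forall>g\<in>#image_mset val J. \<not> int p dvd g" "size (image_mset val J) + 1 \<ge> p"
      using pairs(1) sJ by auto
    from subset_sums_fill_subgroup[OF p2 this] obtain q' I where q': "q' dvd p" "q' < p" "I \<subseteq># image_mset val J"
      and fill: "\<forall>v. int q' dvd v \<longrightarrow> (\<exists>K. K \<subseteq># I \<and> [sum_mset K = v] (mod int p))"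
      by blast
    \<comment> \<open>As \<open>p\<close> is prime, the filled subgroup is the whole group.\<close>
    have "q' = 1 \<or> q' = p" using q'(1) p by (auto simp: prime_nat_iff)
    then have "q' = 1" using q'(2) by simp
    obtain C where C: "H = Refs J + C" using pairs(3) by (auto simp: mset_subset_eq_exists_conv)
    have "size C = 1" using H(2) C size_Refs_Pr[of J] pairs(1) sJ p2 by auto
    then obtain z where z: "C = {#z#}" using size_1_singleton_mset by blast
    obtain K where K: "K \<subseteq># I" "[sum_mset K = - (sum_mset (image_mset snd_ref J) + z)] (mod int p)"
      using fill[rule_format, of "- (sum_mset (image_mset snd_ref J) + z)"] \<open>q' = 1\<close> by auto
    from K(1) q'(3) have "K \<subseteq># image_mset val J" by (rule subset_mset.order_trans)
    then obtain L where L: "L \<subseteq># J" "K = image_mset val L" using sub_image_mset by blast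
    then obtain L' where L': "J = L + L'" by (auto simp: mset_subset_eq_exists_conv)
    \<comment> \<open>Pairs in \<open>L\<close> contribute their first entry and the others their
      second, so the sum is \<open>sum_mset K\<close> plus the fixed amount that \<open>K\<close>
      was chosen to cancel.\<close>
    let ?T = "add_mset z (image_mset fst_ref L + image_mset snd_ref L')"
    have Pr: "\<forall>i\<in>#J. is_Pr i" "\<forall>i\<in>#L. is_Pr i" "\<forall>i\<in>#L'. is_Pr i" using pairs(1) L' by auto
    have "?T \<subseteq># H"
      unfolding C z Refs_Pr[OF Pr(1)] by (simp add: L' add.assoc subset_mset.add_mono)
    moreover have "size ?T = p" using sJ L' p2 by simp
    moreover have "sum_mset ?T = sum_mset K + (sum_mset (image_mset snd_ref J) + z)"
      by (simp add: L(2) L' Val_Pr[OF Pr(2)])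
    then have "[sum_mset ?T = 0] (mod int p)"
      using cong_add[OF K(2) cong_refl, of "sum_mset (image_mset snd_ref J) + z"]
      by (simp add: algebra_simps)
    then have "int p dvd sum_mset ?T" by (simp add: cong_0_iff)
    ultimately show ?thesis using H(1) subset_mset.order_trans by blast
  qed
qed

text \<open>Blocks are split off greedily; before the last one at least \<open>2 * p - 1\<close>
  terms still remain.\<close>

lemma zero_sum_blocks:
  fixes p :: nat
  assumes p: "p > 0"
    and egz: "\<And>G :: int multiset. size G + 1 \<ge> 2 * p \<Longrightarrow> \<exists>T. T \<subseteq># G \<and> size T = p \<and> int p dvd sum_mset T"
    and "size G + 1 \<ge> p * (N + 1)"
  shows "\<exists>Bs. size Bs = N \<and> \<Sum>\<^sub># Bs \<subseteq># G \<and> (\<forall>T\<in>#Bs. size T = p \<and> int p dvd sum_mset T)"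
  using assms(3)
proof (induction N arbitrary: G)
  case 0
  show ?case by (rule exI[of _ "{#}"]) simp
next
  case (Suc N)
  have "p * (Suc N + 1) = 2 * p + p * N" by (simp add: algebra_simps)
  then have "size G + 1 \<ge> 2 * p" using Suc.prems by linarith
  then obtain T where T: "T \<subseteq># G" "size T = p" "int p dvd sum_mset T" using egz by blast
  then obtain G' where G': "G = T + G'" by (auto simp: mset_subset_eq_exists_conv)
  then have "size G' + 1 \<ge> p * (N + 1)" using Suc.prems T(2) by simp
  then obtain Bs where "size Bs = N" "\<Sum>\<^sub># Bs \<subseteq># G'" "\<forall>T\<in>#Bs. size T = p \<and> int p dvd sum_mset T"
    using Suc.IH by blast
  then show ?case using T G' by (intro exI[of _ "add_mset T Bs"]) auto
qed

lemma size_sum_blocks: "\<forall>T\<in>#Bs. size T = p \<Longrightarrow> size (\<Sum>\<^sub># Bs) = p * size Bs"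
  for Bs :: "'a multiset multiset"
  by (induction Bs) auto

lemma sum_mset_Union: "sum_mset (\<Sum>\<^sub># Bs) = (\<Sum>T\<in>#Bs. sum_mset T)" for Bs :: "int multiset multiset"
  by (induction Bs) auto

text \<open>The statement is multiplicative in the modulus: for \<open>n = p * k\<close>, split off
  \<open>2 * k - 1\<close> blocks of length \<open>p\<close> with sums divisible by
  \<open>p\<close>, and apply the case \<open>k\<close> to these sums divided by
  \<open>p\<close>.\<close>

theorem erdos_ginzburg_ziv:
  fixes G :: "int multiset"
  assumes "n > 0" "size G + 1 \<ge> 2 * n"
  shows "\<exists>T. T \<subseteq># G \<and> size T = n \<and> int n dvd sum_mset T"
  using assms
proof (induction n arbitrary: G rule: less_induct)
  case (less n)
  consider "n = 1" | "prime n" | "n > 1" "\<not> prime n" using less.prems(1) by linarith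
  then show ?case
  proof cases
    case 1
    then show ?thesis using ex_sub_mset_size[of 1 G] less.prems by auto
  next
    case 2
    then show ?thesis using egz_prime less.prems(2) by blast
  next
    case 3
    then obtain p where p: "prime p" "p dvd n" using prime_factor_nat[of n] by auto
    then obtain k where n: "n = p * k" by blast
    have k: "k > 0" "k < n" using n less.prems(1) prime_gt_1_nat[OF p(1)] by auto
    have "p * ((2 * k - 1) + 1) = 2 * n" using k n by simp
    then obtain Bs where Bs: "size Bs = 2 * k - 1" "\<Sum>\<^sub># Bs \<subseteq># G" "\<forall>T\<in>#Bs. size T = p \<and> int p dvd sum_mset T"
      using zero_sum_blocks[OF prime_gt_0_nat[OF p(1)] egz_prime[OF p(1)], of "2 * k - 1" G]
        less.prems(2) by auto
    have "size (image_mset (\<lambda>T. sum_mset T div int p) Bs) + 1 \<ge> 2 * k" using Bs(1) k(1) by simp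
    from less.IH[OF k(2) k(1) this]
    obtain M where M: "M \<subseteq># image_mset (\<lambda>T. sum_mset T div int p) Bs" "size M = k" "int k dvd sum_mset M"
      by blast
    obtain Cs where Cs: "Cs \<subseteq># Bs" "M = image_mset (\<lambda>T. sum_mset T div int p) Cs"
      using sub_image_mset[OF M(1)] by blast
    have blk: "\<forall>T\<in>#Cs. size T = p \<and> int p dvd sum_mset T" using Bs(3) Cs(1) by (auto dest: mset_subset_eqD)
    have "sum_mset (\<Sum>\<^sub># Cs) = int p * sum_mset M"
      unfolding Cs(2) sum_mset_Union using blk by (induction Cs) (auto simp: distrib_left)
    then have "int n dvd sum_mset (\<Sum>\<^sub># Cs)" using M(3) n by simp
    moreover have "size (\<Sum>\<^sub># Cs) = n" using size_sum_blocks[of Cs p] blk M(2) Cs(2) n by simp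
    moreover obtain Ds where "Bs = Cs + Ds" using Cs(1) by (auto simp: mset_subset_eq_exists_conv)
    then have "\<Sum>\<^sub># Cs \<subseteq># G" using Bs(2) by (auto elim: subset_mset.order_trans[rotated])
    ultimately show ?thesis by blast
  qed
qed

lemma erdos_ginzburg_ziv_multiple:
  fixes G :: "int multiset"
  assumes "n > 0" "n dvd N" "size G + 1 \<ge> N + n"
  shows "\<exists>T. T \<subseteq># G \<and> size T = N \<and> int n dvd sum_mset T"
proof -
  obtain t where t: "N = n * t" using assms(2) by blast
  then obtain Bs where Bs: "size Bs = t" "\<Sum>\<^sub># Bs \<subseteq># G" "\<forall>T\<in>#Bs. size T = n \<and> int n dvd sum_mset T"
    using zero_sum_blocks[OF assms(1) erdos_ginzburg_ziv[OF assms(1)], of t G] assms(3) by auto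
  moreover have "int n dvd sum_mset (\<Sum>\<^sub># Bs)"
    unfolding sum_mset_Union using Bs(3) by (intro dvd_sum_mset) auto
  ultimately show ?thesis using size_sum_blocks[of Bs n] t by (intro exI[of _ "\<Sum>\<^sub># Bs"]) auto
qed

text \<open>If \<open>J = L + L'\<close>, then \<open>Val L - Val L' = 2 * Val L - Val J\<close>. So
  up to a constant the signed sums are the subset sums of the doubled values, and doubling is
  invertible modulo the odd \<open>k\<close>.\<close>

lemma items_fill_subgroup:
  fixes k :: nat
  assumes "k \<ge> 2" "odd k" "\<forall>i\<in>#I. \<not> int k dvd val i" "size I + 1 \<ge> k"
  shows "\<exists>k' J. k' dvd k \<and> k' < k \<and> J \<subseteq># I \<and> (\<forall>i\<in>#J. int k' dvd val i) \<and> size J + 1 \<le> k div k' \<and>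
    (\<forall>v. int k' dvd v \<longrightarrow> reach (int k) J v)"
proof -
  let ?f = "\<lambda>i. 2 * val i"
  have dvd2: "int l dvd x" if "l dvd k" "int l dvd 2 * x" for l x
  proof -
    have "odd l" using that(1) assms(2) dvd_trans by blast
    then have "coprime (int l) 2" by (simp add: coprime_right_2_iff_odd)
    then show ?thesis using that(2) by (simp add: coprime_dvd_mult_right_iff)
  qed
  have "\<forall>i\<in>#I. \<not> int k dvd ?f i" using assms(3) dvd2[OF dvd_refl] by blast
  then have "\<forall>g\<in>#image_mset ?f I. \<not> int k dvd g" "size (image_mset ?f I) + 1 \<ge> k"
    using assms(4) by simp_all
  from subset_sums_fill_subgroup[OF assms(1) this] obtain k' M where k': "k' dvd k" "k' < k" "M \<subseteq># image_mset ?f I"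
    and M: "\<forall>g\<in>#M. int k' dvd g" "size M + 1 \<le> k div k'"
    and fill: "\<forall>v. int k' dvd v \<longrightarrow> (\<exists>K. K \<subseteq># M \<and> [sum_mset K = v] (mod int k))"
    by blast
  obtain J where J: "J \<subseteq># I" "M = image_mset ?f J" using sub_image_mset[OF k'(3)] by blast
  then have "\<forall>i\<in>#J. int k' dvd ?f i" using M(1) by simp
  then have Jd: "\<forall>i\<in>#J. int k' dvd val i" using dvd2[OF k'(1)] by blast
  have "reach (int k) J v" if v: "int k' dvd v" for v
  proof -
    have "int k' dvd v + Val J" using v Jd by (intro dvd_add dvd_sum_mset) auto
    then obtain K where K: "K \<subseteq># M" "[sum_mset K = v + Val J] (mod int k)" using fill by blast
    obtain L where L: "L \<subseteq># J" "K = image_mset ?f L"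
      using sub_image_mset[OF K(1)[unfolded J(2)]] by blast
    then obtain L' where L': "J = L + L'" by (auto simp: mset_subset_eq_exists_conv)
    have "sum_mset K = 2 * Val L" unfolding L(2) by (induction L) auto
    then have "[Val L - Val L' = v] (mod int k)"
      using K(2) cong_diff[OF K(2) cong_refl, of "Val J"] by (simp add: L')
    then show ?thesis unfolding reach_def using L' by blast
  qed
  moreover have "size J + 1 \<le> k div k'" using M(2) J(2) by simp
  ultimately show ?thesis using k' J(1) Jd by blast
qed

section \<open>One-product subsequences of length n or 2n\<close>

declare size_mset_sum_mset_conv [simp del]

lemma Rots_Rot [simp]: "Rots (image_mset Rot X) = X" by (induction X) auto
lemma Refs_Rot [simp]: "Refs (image_mset Rot X) = {#}" by (induction X) auto
lemma filter_Pr_Rot [simp]: "filter_mset is_Pr (image_mset Rot X) = {#}" by (induction X) auto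

lemma size_Refs: "size (Refs I) = 2 * size (filter_mset is_Pr I)"
proof (induction I)
  case (add i I)
  then show ?case by (cases i) auto
qed auto

lemma size_Rots: "size (Rots I) + size (filter_mset is_Pr I) = size I"
proof (induction I)
  case (add i I)
  then show ?case by (cases i) auto
qed auto

lemma Refs_filter: "Refs (filter_mset is_Pr I) = Refs I"
proof (induction I)
  case (add i I)
  then show ?case by (cases i) auto
qed auto

lemma Rots_filter: "image_mset Rot (Rots I) = filter_mset (\<lambda>i. \<not> is_Pr i) I"
proof (induction I)
  case (add i I)
  then show ?case by (cases i) auto
qed auto

lemma reach_dvd:
  assumes "\<And>i. i \<in># I \<Longrightarrow> k dvd val i"
  shows "reach k I 0"
  unfolding reach_def using dvd_sum_mset[of I k val] assms
  by (intro exI[of _ I] exI[of _ "{#}"]) (simp add: cong_0_iff)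

lemma reach_add:
  assumes "reach k I u" "reach k J v"
  shows "reach k (I + J) (u + v)"
proof -
  obtain I1 I2 J1 J2 where "I = I1 + I2" "J = J1 + J2"
    and c: "[Val I1 - Val I2 = u] (mod k)" "[Val J1 - Val J2 = v] (mod k)"
    using assms by (auto simp: reach_def)
  then have "I + J = (I1 + J1) + (I2 + J2)" by simp
  moreover have "[Val (I1 + J1) - Val (I2 + J2) = u + v] (mod k)"
    using cong_add[OF c] by (simp add: algebra_simps)
  ultimately show ?thesis unfolding reach_def by blast
qed

text \<open>A signed sum known only modulo \<open>k\<close> misses its target by a multiple of
  \<open>k\<close>, which \<open>F\<close> corrects modulo \<open>n\<close>.\<close>

lemma reach_fill:
  assumes "reach k J v" "\<And>u. k dvd u \<Longrightarrow> reach n F u"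
  shows "reach n (F + J) v"
proof -
  obtain J1 J2 where J: "J = J1 + J2" "[Val J1 - Val J2 = v] (mod k)"
    using assms(1) by (auto simp: reach_def)
  have "k dvd v - (Val J1 - Val J2)" using cong_sym[OF J(2)] by (simp add: cong_iff_dvd_diff)
  then have "reach n F (v - (Val J1 - Val J2))" by (rule assms(2))
  moreover have "reach n J (Val J1 - Val J2)"
    unfolding reach_def using J(1) by (intro exI[of _ J1] exI[of _ J2]) simp
  ultimately show ?thesis using reach_add by fastforce
qed

definition has_one_product :: "nat \<Rightarrow> int multiset \<Rightarrow> int multiset \<Rightarrow> nat \<Rightarrow> bool" where
  "has_one_product n A B l \<longleftrightarrow>
    (\<exists>T. T \<subseteq># dseq n A B \<and> one_product_seq (dihedral_group n) T \<and> size T = l)"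

lemma has_one_product_items:
  assumes "n \<ge> 3" "reach (int n) I 0" "size (filter_mset is_Pr I) > 0" "Rots I \<subseteq># A" "Refs I \<subseteq># B"
    "size (Rots I) + size (Refs I) = l"
  shows "has_one_product n A B l"
proof -
  have "filter_mset is_Pr I \<noteq> {#}" using assms(3) by force
  then obtain i where "i \<in># filter_mset is_Pr I" by blast
  then have "i \<in># I" "is_Pr i" by simp_all
  then obtain b c where "Pr b c \<in># I" by (auto elim: is_PrE)
  then show ?thesis
    unfolding has_one_product_def
    using one_product_seq_items[OF assms(1,2)] dseq_mono[OF assms(4,5)] assms(6)
    by (intro exI[of _ "dseq n (Rots I) (Refs I)"]) auto
qed

lemma has_one_product_rots:
  assumes "n \<ge> 3" "T \<subseteq># A" "int n dvd sum_mset T"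
  shows "has_one_product n A B (size T)"
  unfolding has_one_product_def
  using one_product_seq_rots[OF assms(1), of T] dseq_mono[OF assms(2), of "{#}" B] assms(3)
  by (intro exI[of _ "dseq n T {#}"]) (auto simp: cong_0_iff)

text \<open>A length \<open>q\<close> is composed of \<open>x\<close> rotations and \<open>y\<close>
  pairs; an odd \<open>q\<close> requires a rotation. The last clause secures a pair of reflections
  whenever one is available and \<open>q >= 2\<close>.\<close>

lemma split_length:
  fixes w c q :: nat
  assumes "w \<ge> 1 \<or> even q" "q \<le> w + 2 * c"
  obtains x y where "x \<le> w" "y \<le> c" "x + 2 * y = q" "y = 0 \<longrightarrow> q \<le> 1 \<or> c = 0"
proof (cases "q div 2 \<le> c")
  case True
  show ?thesis by (rule that[of "q mod 2" "q div 2"]) (use assms True in \<open>auto simp: mod_2_eq_odd\<close>)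
next
  case False
  show ?thesis by (rule that[of "q - 2 * c" c]) (use assms False in auto)
qed

lemma two_power_ge: "t \<ge> 3 \<Longrightarrow> (2::nat) ^ t \<ge> 2 * t + 2"
  by (induction t rule: nat_induct_at_least) auto

text \<open>Guarantees that \<open>t + 1\<close> items including a rotation, which have at most
  \<open>2 * t + 1\<close> terms, fit into length \<open>k\<close>. For \<open>t = 2\<close> oddness
  excludes the value 4.\<close>

lemma log_bound:
  assumes "2 ^ t \<le> k" "odd k" "k \<ge> (3::nat)"
  shows "2 * t + 1 \<le> k"
proof -
  consider "t = 0" | "t = 1" | "t = 2" | "t \<ge> 3" by linarith
  then show ?thesis
  proof cases
    case 3
    then have "k \<noteq> 4" "k \<ge> 4" using assms by auto
    then show ?thesis using 3 by simp
  next
    case 4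
    then show ?thesis using two_power_ge[of t] assms(1) by linarith
  qed (use assms in auto)
qed

lemma ex_log2: "k > 0 \<Longrightarrow> \<exists>t. 2 ^ t \<le> k \<and> k < 2 ^ (t + 1)" for k :: nat
  using ex_power_ivl1[of 2 k] by auto

lemma product_bounds:
  fixes k h :: nat
  assumes "k \<ge> 3" "h \<ge> 1"
  shows "3 * h \<le> k * h" "2 * h + k \<le> k * h + 2" "h + k \<le> k * h + 1"
proof -
  obtain a b where ab: "k = 3 + a" "h = 1 + b" using assms by (metis le_Suc_ex)
  show "3 * h \<le> k * h" "2 * h + k \<le> k * h + 2" "h + k \<le> k * h + 1"
    unfolding ab by (simp_all add: algebra_simps)
qed

lemma product_bounds':
  fixes k h :: nat
  assumes "k \<ge> 3" "h \<ge> 3"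
  shows "3 * k \<le> k * h" "2 * h + 3 * k \<le> 2 * (k * h) + 3"
proof -
  obtain a b where ab: "k = 3 + a" "h = 3 + b" using assms by (metis le_Suc_ex)
  show "3 * k \<le> k * h" "2 * h + 3 * k \<le> 2 * (k * h) + 3"
    unfolding ab by (simp_all add: algebra_simps)
qed

text \<open>The multiset \<open>F\<close> fills the subgroup of multiples of \<open>k\<close>; \<open>W\<close> and \<open>E\<close> are the remaining rotations
  inside and outside this subgroup, and \<open>C\<close> are the remaining reflections. The assumption \<open>spare\<close>
  says that, for \<open>k = 1\<close>, not every rotation is used up by \<open>F\<close>: one is kept to correct the parity
  of the number of reflections.\<close>

locale filling =
  fixes n m k :: nat and A B :: "int multiset" and F :: "item multiset" and W E C :: "int multiset"
  assumes n: "n \<ge> 3" "odd n" and m: "2 ^ m \<le> n" "n < 2 ^ (m + 1)" and kn: "k dvd n"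
    and A: "A = Rots F + W + E" and B: "B = Refs F + C"
    and W: "\<forall>a\<in>#W. int k dvd a"
    and F_small: "size F + 1 \<le> n div k" and F_dvd: "\<forall>i\<in>#F. int k dvd val i"
    and F_fill: "\<And>v. int k dvd v \<Longrightarrow> reach (int n) F v"
    and size_AB: "size A + size B = 2 * n + m" and size_B: "size B \<ge> 3"
    and few: "\<And>J. k \<ge> 2 \<Longrightarrow> \<forall>i\<in>#J. is_Pr i \<and> \<not> int k dvd val i \<Longrightarrow> Refs J \<subseteq># C \<Longrightarrow>
      size E + size J + 1 \<le> k"
    and E: "\<forall>a\<in>#E. \<not> int k dvd a"
    and spare: "k = 1 \<Longrightarrow> W = {#} \<Longrightarrow> Rots F = {#}"
begin

text \<open>\<open>F\<close> takes up \<open>f1 + 2 * f2\<close> terms of the sequence, and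
  \<open>h\<close> is the order of the subgroup of multiples of \<open>k\<close> modulo
  \<open>n\<close>.\<close>

abbreviation "f1 \<equiv> size (Rots F)"
abbreviation "f2 \<equiv> size (filter_mset is_Pr F)"
abbreviation "h \<equiv> n div k"

lemma nkh: "n = k * h" "k > 0" "h > 0" "odd k" "odd h"
proof -
  show nkh: "n = k * h" using kn by simp
  show "k > 0" "h > 0" using nkh n(1) by (auto intro!: Nat.gr0I)
  show "odd k" "odd h" using n(2) nkh by (metis even_mult_iff)+
qed

lemma sizes: "f1 + 2 * f2 + size W + size E + size C = 2 * n + m" "f1 + f2 + 1 \<le> h"
    "2 * f2 + size C \<ge> 3"
  using size_AB size_B size_Refs[of F] size_Rots[of F] F_small by (auto simp: A B)

lemma m_pos: "m \<ge> 1" using m n by (cases m) auto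

lemma k_h_bounds:
  assumes "k \<ge> 3"
  shows "3 * h \<le> n" "2 * h + k \<le> n + 2" "h + k \<le> n + 1"
  using product_bounds[OF assms, of h] nkh(1,3) by linarith+

lemma h_bounds:
  assumes "k \<ge> 3" "h \<ge> 3"
  shows "3 * k \<le> n" "2 * h + 3 * k \<le> 2 * n + 3"
  using product_bounds'[OF assms] nkh(1) by linarith+

text \<open>Outside \<open>F\<close> a signed zero sum modulo \<open>k\<close> suffices, since
  \<open>F\<close> lifts it to modulus \<open>n\<close>. A pair of reflections must occur in
  \<open>F\<close> or in \<open>U\<close> to make the signs available.\<close>

lemma finish:
  assumes "reach (int k) U 0" "Rots U \<subseteq># W + E" "Refs U \<subseteq># C"
    and "f2 + size (filter_mset is_Pr U) > 0"
    and "f1 + 2 * f2 + size (Rots U) + size (Refs U) = l"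
  shows "has_one_product n A B l"
proof (rule has_one_product_items[OF n(1)])
  show "reach (int n) (F + U) 0"
    using reach_fill[OF assms(1) F_fill] .
  show "size (filter_mset is_Pr (F + U)) > 0" using assms(4) by (simp only: filter_union_mset size_union)
  show "Rots (F + U) \<subseteq># A" using assms(2) by (simp add: A add.assoc)
  show "Refs (F + U) \<subseteq># B" using assms(3) by (simp add: B)
  show "size (Rots (F + U)) + size (Refs (F + U)) = l" using assms(5) by (simp add: size_Refs)
qed

text \<open>Rotations in \<open>W\<close> and pairs congruent modulo \<open>k\<close> contribute
  zero modulo \<open>k\<close>, so any number of them may be taken and only the length
  matters.\<close>

lemma finish_zero_items:
  assumes "x \<le> size W" "y \<le> size J" "\<forall>i\<in>#J. is_Pr i \<and> int k dvd val i" "Refs J \<subseteq># C"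
    "f2 + y > 0" "f1 + 2 * f2 + x + 2 * y = l"
  shows "has_one_product n A B l"
proof -
  obtain W' where W': "W' \<subseteq># W" "size W' = x" using ex_sub_mset_size[OF assms(1)] by blast
  obtain J' where J': "J' \<subseteq># J" "size J' = y" using ex_sub_mset_size[OF assms(2)] by blast
  have J: "\<forall>i\<in>#J'. is_Pr i \<and> int k dvd val i" using assms(3) J'(1) by (auto dest: mset_subset_eqD)
  have fJ: "filter_mset is_Pr J' = J'" using J by (simp add: filter_mset_eq_conv)
  show ?thesis
  proof (rule finish[of "image_mset Rot W' + J'"])
    show "reach (int k) (image_mset Rot W' + J') 0"
      using J W W'(1) by (intro reach_dvd) (auto dest: mset_subset_eqD)
    show "Rots (image_mset Rot W' + J') \<subseteq># W + E"
      using W'(1) J by (simp add: Rots_Pr subset_mset.add_increasing2)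
    show "Refs (image_mset Rot W' + J') \<subseteq># C"
      using Refs_mono[OF J'(1)] assms(4) by (simp add: subset_mset.order_trans[of _ "Refs J"])
    show "f2 + size (filter_mset is_Pr (image_mset Rot W' + J')) > 0"
      using assms(5) J'(2) by (simp only: filter_union_mset size_union fJ filter_Pr_Rot size_empty add_0)
    show "f1 + 2 * f2 + size (Rots (image_mset Rot W' + J')) + size (Refs (image_mset Rot W' + J')) = l"
      using assms(6) W'(2) J'(2) J by (simp add: Rots_Pr size_Refs fJ)
  qed
qed

text \<open>Here rotations alone are used. Dividing those in the subgroup by \<open>k\<close> lowers
  the modulus to \<open>h\<close>, so \<open>n + h - 1\<close> of them suffice for a zero sum of
  length \<open>n\<close>.\<close>

lemma finish_egz:
  assumes "f1 + size W + 1 \<ge> n + h"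
  shows "has_one_product n A B n"
proof -
  let ?G = "Rots F + W"
  have rots: "\<forall>a\<in>#Rots F. int k dvd a"
  proof
    fix a assume "a \<in># Rots F"
    then have "Rot a \<in># image_mset Rot (Rots F)" by simp
    then have "Rot a \<in># F" unfolding Rots_filter by simp
    then show "int k dvd a" using F_dvd by force
  qed
  have "size (image_mset (\<lambda>a. a div int k) ?G) + 1 \<ge> n + h" using assms by simp
  from erdos_ginzburg_ziv_multiple[OF nkh(3) _ this]
  obtain T where T: "T \<subseteq># image_mset (\<lambda>a. a div int k) ?G" "size T = n" "int h dvd sum_mset T"
    using nkh(1) by (metis dvd_triv_right)
  have "image_mset ((*) (int k)) T \<subseteq># image_mset ((*) (int k)) (image_mset (\<lambda>a. a div int k) ?G)"
    by (rule image_mset_subseteq_mono[OF T(1)])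
  also have "\<dots> = image_mset (\<lambda>a. a) ?G"
    unfolding image_mset.compositionality using rots W by (intro image_mset_cong) auto
  finally have "image_mset ((*) (int k)) T \<subseteq># A" by (simp add: A subset_mset.add_increasing2)
  moreover have "sum_mset (image_mset ((*) (int k)) T) = int k * sum_mset T"
    by (induction T) (auto simp: distrib_left)
  then have "int n dvd sum_mset (image_mset ((*) (int k)) T)"
    using T(3) nkh(1) by (metis dvd_refl mult_dvd_mono of_nat_mult)
  ultimately show ?thesis using has_one_product_rots[OF n(1)] T(2) by (metis size_image_mset)
qed

section \<open>Completing a filling to length n or 2n\<close>

lemma case_trivial:
  assumes "k = 1"
  shows "has_one_product n A B (2 * n)"
proof -
  have hn: "h = n" using assms by simp
  have "E = {#}" using E assms by (cases E) auto
  have s: "f1 + 2 * f2 + size W + size C = 2 * n + m" "f1 + f2 + 1 \<le> n"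
    using sizes \<open>E = {#}\<close> hn by auto
  define q where "q = 2 * n - (f1 + 2 * f2)"
  have q: "f1 + 2 * f2 + q = 2 * n" "q \<ge> 2" using s by (auto simp: q_def)
  \<comment> \<open>Modulo 1 only length and parity matter. If no rotation is left, \<open>F\<close>
    contains none either by \<open>spare\<close>, and then \<open>q\<close> is even.\<close>
  have "size W \<ge> 1 \<or> even q"
  proof (cases "W = {#}")
    case True
    then have "f1 = 0" using spare assms by simp
    then show ?thesis using q(1) by presburger
  next
    case False
    then have "size W \<noteq> 0" by simp
    then show ?thesis by linarith
  qed
  \<comment> \<open>Pairing may waste one reflection; the surplus \<open>m >= 1\<close> in the total
    length covers it.\<close>
  moreover have "q \<le> size W + 2 * (size C div 2)"
  proof -
    have "size C \<le> 2 * (size C div 2) + 1" by simp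
    then show ?thesis using s(1) q(1) m_pos by linarith
  qed
  ultimately obtain x y where xy: "x \<le> size W" "y \<le> size C div 2" "x + 2 * y = q"
    "y = 0 \<longrightarrow> q \<le> 1 \<or> size C div 2 = 0" by (rule split_length)
  have "2 * y \<le> size C" using xy(2) by linarith
  then obtain J where J: "\<forall>i\<in>#J. is_Pr i" "size J = y" "Refs J \<subseteq># C"
    by (rule pair_items)
  have "f2 + y > 0"
  proof (rule ccontr)
    assume "\<not> ?thesis"
    then have "y = 0" "f2 = 0" by linarith+
    then have "size C \<le> 1" "f2 = 0" using xy(4) q(2) by linarith+
    then show False using sizes(3) by linarith
  qed
  then show ?thesis
    using finish_zero_items[of x y J "2 * n"] xy(1,3) J q(1) assms by simp
qed

text \<open>Up to translation the residue class \<open>c\<close> is zero, and its reflections pad and balance freely. If no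
  rotation is available for the parity, either some signed zero sum modulo \<open>k\<close> uses an odd number of
  rotations, which leads to length \<open>n\<close>, or all but \<open>log\<^sub>2 k\<close> exceptional terms lie in signed zero sums
  with an even number of rotations, which leads to length \<open>2n\<close>.\<close>

lemma case_majority:
  assumes k3: "k \<ge> 3"
    and maj: "size {#b \<in># C. b mod int k \<noteq> c#} \<le> size {#b \<in># C. b mod int k = c#}"
  shows "has_one_product n A B n \<or> has_one_product n A B (2 * n)"
proof -
  define X where "X = {#b \<in># C. b mod int k \<noteq> c#}"
  define Z where "Z = {#b \<in># C. b mod int k = c#}"
  have C: "C = X + Z" unfolding X_def Z_def using multiset_partition[of C "\<lambda>b. b mod int k = c"]
    by (simp add: add.commute)
  have Z_dvd: "int k dvd val i" if i: "is_Pr i" "refs i \<subseteq># Z" for i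
  proof -
    obtain a b where ab: "i = Pr a b" using i(1) by (auto elim: is_PrE)
    then have "a \<in># Z" "b \<in># Z" using i(2) by (auto dest: mset_subset_eqD)
    then show ?thesis by (auto simp: ab Z_def mod_eq_dvd_iff[symmetric])
  qed
  have Z_pairs: "\<exists>J. (\<forall>i\<in>#J. is_Pr i \<and> int k dvd val i) \<and> size J = y \<and> Refs J \<subseteq># Z'"
    if y: "2 * y \<le> size Z'" "Z' \<subseteq># Z" for y Z'
  proof -
    obtain J where J: "\<forall>i\<in>#J. is_Pr i" "size J = y" "Refs J \<subseteq># Z'" using pair_items[OF y(1)] by blast
    have "int k dvd val i" if i: "i \<in># J" for i
    proof -
      obtain K where "J = add_mset i K" using i by (meson multi_member_split)
      then have "refs i \<subseteq># Refs J" by simp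
      then have "refs i \<subseteq># Z" using J(3) \<open>Z' \<subseteq># Z\<close> subset_mset.order_trans by blast
      then show ?thesis using Z_dvd J(1) i by blast
    qed
    then show ?thesis using J by blast
  qed
  have XZ: "size X \<le> size Z" using maj by (simp add: X_def Z_def)
  \<comment> \<open>Each exceptional reflection in \<open>X\<close> gets its own partner in
    \<open>Z\<close>. These pairs are nonzero modulo \<open>k\<close>, so \<open>few\<close> bounds
    \<open>size E + size X\<close> by \<open>k - 1\<close>.\<close>
  then obtain J0 where J0: "\<forall>i\<in>#J0. is_Pr i" "image_mset fst_ref J0 = X" "image_mset snd_ref J0 \<subseteq># Z"
    by (rule zip_items)
  have "\<not> int k dvd val i" if i: "i \<in># J0" for i
  proof -
    have "is_Pr i" using J0(1) i by blast
    then obtain a b where ab: "i = Pr a b" by (rule is_PrE)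
    have "a \<in># X" using J0(2) i ab by force
    moreover have "b \<in># image_mset snd_ref J0" using i ab by force
    then have "b \<in># Z" using J0(3) by (rule mset_subset_eqD[rotated])
    ultimately show ?thesis by (auto simp: ab X_def Z_def mod_eq_dvd_iff[symmetric])
  qed
  moreover have "Refs J0 \<subseteq># C" using J0 by (simp add: Refs_Pr C)
  ultimately have EX: "size E + size X + 1 \<le> k"
    using few[of J0] J0(1) k3 size_image_mset[of fst_ref J0] by (simp add: J0(2))
  have sC: "size C = size X + size Z" by (simp add: C)
  note kh = k_h_bounds[OF k3]
  define q where "q = n - (f1 + 2 * f2)"
  have q: "f1 + 2 * f2 + q = n" "q \<ge> k" using sizes(2) kh by (auto simp: q_def)
  show ?thesis
  proof (cases "size W \<ge> 1 \<or> even q")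
    case True
    have "size Z \<le> 2 * (size Z div 2) + 1" by simp
    moreover have "k \<le> n" using kh(2) nkh(3) by linarith
    ultimately have "q \<le> size W + 2 * (size Z div 2)" using sizes(1) sC EX q(1) by linarith
    with True obtain x y where xy: "x \<le> size W" "y \<le> size Z div 2" "x + 2 * y = q"
      "y = 0 \<longrightarrow> q \<le> 1 \<or> size Z div 2 = 0" by (rule split_length)
    have "2 * y \<le> size Z" using xy(2) by linarith
    from Z_pairs[OF this] obtain J
      where J: "\<forall>i\<in>#J. is_Pr i \<and> int k dvd val i" "size J = y" "Refs J \<subseteq># Z" by auto
    have "f2 + y > 0"
    proof (rule ccontr)
      assume "\<not> ?thesis"
      then have "y = 0" "f2 = 0" by linarith+
      then have "size Z \<le> 1" using xy(4) q(2) k3 by linarith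
      then show False using sizes(3) sC XZ \<open>f2 = 0\<close> by linarith
    qed
    moreover have "Refs J \<subseteq># C" using J(3) by (simp add: C subset_mset.add_increasing)
    ultimately have "has_one_product n A B n"
      using finish_zero_items[of x y J n] xy(1,3) J(1,2) q(1) by simp
    then show ?thesis by simp
  next
    case False
    then have W0: "size W = 0" and oq: "odd q" by linarith+
    define I0 where "I0 = image_mset Rot E + J0"
    \<comment> \<open>Padding: a signed zero sum \<open>U\<close> of exceptional items is brought to
      length \<open>l\<close> by \<open>y\<close> pairs from \<open>Z\<close>. Every pair in
      \<open>U\<close> already occupies one element of \<open>Z\<close>, whence the left side of the
      first bound \<open>y\<close>.\<close>
    have fin: "has_one_product n A B l"
      if U: "U \<subseteq># I0" "reach (int k) U 0" and l: "f1 + 2 * f2 + size (Rots U) + size (Refs U) + 2 * y = l"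
        and y: "size (filter_mset is_Pr U) + 2 * y \<le> size Z" "size (filter_mset is_Pr U) + y > 0" for U y l
    proof -
      define U2 where "U2 = filter_mset is_Pr U"
      have "U2 \<subseteq># filter_mset is_Pr I0" unfolding U2_def by (rule multiset_filter_mono[OF U(1)])
      also have "filter_mset is_Pr I0 = J0" using J0(1) by (simp add: I0_def filter_mset_eq_conv)
      finally have U2: "U2 \<subseteq># J0" .
      have fs: "image_mset fst_ref U2 \<subseteq># X" "image_mset snd_ref U2 \<subseteq># Z"
        using image_mset_subseteq_mono[OF U2, of fst_ref] image_mset_subseteq_mono[OF U2, of snd_ref]
          J0(2,3) subset_mset.order_trans by auto
      have "\<forall>i\<in>#U2. is_Pr i" by (simp add: U2_def)
      then have RU: "Refs U = image_mset fst_ref U2 + image_mset snd_ref U2"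
        using Refs_Pr[of U2] Refs_filter[of U] by (simp add: U2_def)
      define Z' where "Z' = Z - image_mset snd_ref U2"
      have "size Z' = size Z - size U2" using fs(2) by (simp add: Z'_def size_Diff_submset)
      then have "2 * y \<le> size Z'" using y(1) by (simp add: U2_def)
      moreover have "Z' \<subseteq># Z" by (simp add: Z'_def)
      ultimately obtain J where J: "\<forall>i\<in>#J. is_Pr i \<and> int k dvd val i" "size J = y" "Refs J \<subseteq># Z'"
        using Z_pairs[of y Z'] by auto
      have fJ: "filter_mset is_Pr J = J" using J(1) by (simp add: filter_mset_eq_conv)
      show ?thesis
      proof (rule finish[of "U + J"])
        show "reach (int k) (U + J) 0"
          using reach_add[OF U(2) reach_dvd[of J "int k"]] J(1) by simp
        have "Rots U \<subseteq># Rots I0" by (rule Rots_mono[OF U(1)])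
        then show "Rots (U + J) \<subseteq># W + E"
          using J(1) J0(1) by (simp add: I0_def Rots_Pr subset_mset.add_increasing)
        have "image_mset snd_ref U2 + Refs J \<subseteq># Z"
          using J(3) fs(2) by (simp add: Z'_def subset_mset.le_diff_conv2 add.commute)
        then show "Refs (U + J) \<subseteq># C"
          using fs(1) by (simp add: RU C add.assoc subset_mset.add_mono)
        show "f2 + size (filter_mset is_Pr (U + J)) > 0"
          using y(2) J(2) by (simp only: filter_union_mset size_union fJ)
        show "f1 + 2 * f2 + size (Rots (U + J)) + size (Refs (U + J)) = l"
          using l J by (simp add: Rots_Pr size_Refs fJ)
      qed
    qed
    \<comment> \<open>\<open>t\<close> is the integer part of the base 2 logarithm of
      \<open>k\<close>, so any \<open>t + 1\<close> items contain a signed zero sum modulo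
      \<open>k\<close>.\<close>
    obtain t where t: "2 ^ t \<le> k" "k < 2 ^ (t + 1)" using ex_log2[OF nkh(2)] by blast
    have tk: "2 * t + 1 \<le> k" using log_bound[OF t(1) nkh(4) k3] .
    have t1: "t \<ge> 1" using t(2) k3 by (cases t) auto
    have "(2::nat) ^ t < 2 ^ (m + 1)" using t(1) m(2) kh(2) nkh(3) by linarith
    then have "t < m + 1" by (rule power_less_imp_less_exp[rotated]) simp
    then have tm: "t \<le> m" by simp
    show ?thesis
    proof (cases "\<exists>U. U \<subseteq># I0 \<and> reach (int k) U 0 \<and> size U \<le> t + 1 \<and> odd (size (Rots U))")
      case True
      then obtain U where U: "U \<subseteq># I0" "reach (int k) U 0" "size U \<le> t + 1" "odd (size (Rots U))" by blast
      let ?u1 = "size (Rots U)" and ?u2 = "size (filter_mset is_Pr U)"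
      have u: "?u1 + ?u2 = size U" "?u1 \<ge> 1" using size_Rots[of U] U(4) by (auto intro: Suc_leI odd_pos)
      \<comment> \<open>An odd number of rotations in \<open>U\<close> makes the missing length
        even, so pairs alone can supply it.\<close>
      have "even (q - ?u1 - 2 * ?u2)" using oq U(4) by simp
      then obtain y where y: "q - ?u1 - 2 * ?u2 = 2 * y" by blast
      have "q \<ge> 2 * t + 1" using q(2) tk by linarith
      moreover have "?u1 + 2 * ?u2 \<le> 2 * t + 1" using u U(3) by linarith
      ultimately have y': "?u1 + 2 * ?u2 + 2 * y = q" using y by linarith
      have "has_one_product n A B n"
      proof (rule fin[OF U(1,2), of y])
        show "f1 + 2 * f2 + ?u1 + size (Refs U) + 2 * y = n" using y' q(1) by (simp add: size_Refs)
        show "?u2 + 2 * y \<le> size Z" using y' sizes(1) W0 sC EX q(1) nkh kh by linarith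
        show "?u2 + y > 0" using y' u U(3) t1 \<open>q \<ge> 2 * t + 1\<close> by linarith
      qed
      then show ?thesis by simp
    next
      case False
      \<comment> \<open>Now every signed zero sum of at most \<open>t + 1\<close> items has an even
        number of rotations, so an even one can be enlarged as long as \<open>t + 1\<close> items
        remain.\<close>
      define P where "P U \<longleftrightarrow> U \<subseteq># I0 \<and> reach (int k) U 0 \<and> even (size (Rots U))" for U
      have "P {#}" unfolding P_def using reach_dvd[of "{#}" "int k"] by simp
      moreover have "\<forall>U. P U \<longrightarrow> size U < Suc (size I0)" by (auto simp: P_def less_Suc_eq_le size_mset_mono)
      ultimately obtain U where U: "P U" and Umax: "\<And>V. P V \<Longrightarrow> size V \<le> size U"
        using ex_has_greatest_nat[of P "{#}" size "Suc (size I0)"] by blast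
      obtain V where V: "I0 = U + V" using U by (auto simp: P_def mset_subset_eq_exists_conv)
      have "size V \<le> t"
      proof (rule ccontr)
        assume "\<not> ?thesis"
        then have "t + 1 \<le> size V" by simp
        then obtain Y where Y: "Y \<subseteq># V" "Y \<noteq> {#}" "size Y \<le> t + 1" "reach (int k) Y 0"
          using signed_pigeonhole[OF nkh(2) t(2)] by blast
        have "Y \<subseteq># I0" using Y(1) by (simp add: V subset_mset.add_increasing)
        then have "even (size (Rots Y))" using False Y by blast
        then have "P (U + Y)"
          using U Y(1) reach_add[OF _ Y(4), of U 0] by (simp add: P_def V)
        then show False using Umax[of "U + Y"] Y(2) by simp
      qed
      let ?u1 = "size (Rots U)" and ?u2 = "size (filter_mset is_Pr U)"
      have sJ0: "size J0 = size X" using J0(2) size_image_mset[of fst_ref J0] by simp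
      have "size I0 = size U + size V" by (simp add: V)
      then have uE: "?u1 + ?u2 + size V = size E + size X"
        using size_Rots[of U] sJ0 by (simp add: I0_def)
      \<comment> \<open>Since \<open>n\<close> and \<open>q\<close> are odd, \<open>f1\<close> is
        even; hence \<open>2 * n\<close> is the length with the right parity.\<close>
      have "even (2 * n - (f1 + 2 * f2) - ?u1 - 2 * ?u2)"
      proof -
        have "odd (f1 + 2 * f2 + q)" using q(1) n(2) by simp
        then have "even f1" using oq by simp
        then show ?thesis using U by (simp add: P_def)
      qed
      then obtain y where y: "2 * n - (f1 + 2 * f2) - ?u1 - 2 * ?u2 = 2 * y" by blast
      have y': "f1 + 2 * f2 + ?u1 + 2 * ?u2 + 2 * y = 2 * n"
        using y uE EX sizes(2) kh(3) by linarith
      have "has_one_product n A B (2 * n)"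
      proof (rule fin[of U y])
        show "U \<subseteq># I0" "reach (int k) U 0" using U by (auto simp: P_def)
        show "f1 + 2 * f2 + ?u1 + size (Refs U) + 2 * y = 2 * n" using y' by (simp add: size_Refs)
        \<comment> \<open>Each item of \<open>V\<close> that is left out costs one unit here. There
          are at most \<open>t\<close> of them, and the surplus \<open>m >= t\<close> in the total
          length pays for them.\<close>
        show "?u2 + 2 * y \<le> size Z" using y' sizes(1) W0 sC uE \<open>size V \<le> t\<close> tm by linarith
        show "?u2 + y > 0" using y' uE EX sizes(2) kh by linarith
      qed
      then show ?thesis by simp
    qed
  qed
qed

text \<open>The incongruent pairs and \<open>few\<close> bound \<open>size E + size C div 2\<close>
  by \<open>k - 1\<close>; this forces \<open>W\<close> to be nonempty, so parity is no obstacle. If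
  \<open>h >= 3\<close>, length \<open>n\<close> is reached by \<open>W\<close> with congruent pairs
  or by rotations alone. If \<open>h = 1\<close>, \<open>F\<close> is empty and any shortage is met
  by signed zero sums of rotations in \<open>E\<close> and pairs.\<close>

lemma case_no_majority:
  assumes k3: "k \<ge> 3"
    and J0: "\<forall>i\<in>#J0. is_Pr i \<and> \<not> int k dvd val i" "size J0 = size C div 2" "Refs J0 \<subseteq># C"
  shows "has_one_product n A B n"
proof -
  define t0 where "t0 = size C div 2"
  have C: "2 * t0 \<le> size C" "size C \<le> 2 * t0 + 1" by (auto simp: t0_def)
  have Et: "size E + t0 + 1 \<le> k" using few[OF _ J0(1,3)] k3 J0(2) by (simp add: t0_def)
  note kh = k_h_bounds[OF k3]
  define q where "q = n - (f1 + 2 * f2)"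
  have q: "f1 + 2 * f2 + q = n" "q \<ge> k" using sizes(2) kh by (auto simp: q_def)
  have w: "size W \<ge> 1" using sizes Et C kh q m_pos by linarith
  \<comment> \<open>The number of congruent pairs that \<open>equal_pair_items\<close> provides;
    truncated subtraction gives 0 if there are too few reflections.\<close>
  define c where "c = (size C + 1 - k) div 2"
  have c: "2 * c + k \<ge> size C" by (simp add: c_def)
  have "\<exists>J. (\<forall>i\<in>#J. is_Pr i \<and> int k dvd val i) \<and> size J = c \<and> Refs J \<subseteq># C"
  proof (cases "c = 0")
    case True
    then show ?thesis by (intro exI[of _ "{#}"]) simp
  next
    case False
    then have "2 * c + k \<le> size C + 1" by (simp add: c_def)
    then show ?thesis by (rule equal_pair_items[OF nkh(2)])
  qed
  then obtain J where J: "\<forall>i\<in>#J. is_Pr i \<and> int k dvd val i" "size J = c" "Refs J \<subseteq># C" by blast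
  have pad: "has_one_product n A B n" if D: "q \<le> size W + 2 * c" "f2 + c > 0"
  proof -
    have "size W \<ge> 1 \<or> even q" using w by simp
    then obtain x y where xy: "x \<le> size W" "y \<le> c" "x + 2 * y = q"
      "y = 0 \<longrightarrow> q \<le> 1 \<or> c = 0" using D(1) by (rule split_length)
    have "f2 + y > 0" using xy(4) D(2) q(2) k3 by linarith
    then show ?thesis using finish_zero_items[of x y J n] xy J q(1) by simp
  qed
  consider "h = 1" | "h \<ge> 3" using nkh(3,5) by (cases "h = 2") (auto, linarith)
  then show ?thesis
  proof cases
    case 2
    note hb = h_bounds[OF k3 2]
    have D: "q \<le> size W + 2 * c" using sizes(1) Et C c q(1) hb(1) nkh(2) by linarith
    show ?thesis
    proof (cases "f2 + c > 0")
      case True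
      then show ?thesis by (rule pad[OF D])
    next
      case False
      then have "size C \<le> k" "f2 = 0" using c by linarith+
      then have "f1 + size W + 1 \<ge> n + h" using sizes(1) Et C hb(2) by linarith
      then show ?thesis by (rule finish_egz)
    qed
  next
    case 1
    have kn': "k = n" using nkh(1) 1 by simp
    have f: "f1 = 0" "f2 = 0" using sizes(2) 1 by linarith+
    show ?thesis
    proof (cases "size W \<ge> n \<or> n \<le> size W + 2 * c")
      case True
      show ?thesis
      proof (cases "size W \<ge> n")
        case True
        then show ?thesis using finish_egz 1 f by simp
      next
        case False
        then have "c > 0" "n \<le> size W + 2 * c" using True by linarith+
        then have "q \<le> size W + 2 * c" "f2 + c > 0" using q(1) f by linarith+
        then show ?thesis by (rule pad)
      qed
    next
      case False
      then have wn: "size W < n" "size W + 2 * c < n" by auto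
      \<comment> \<open>Preparations for a greedy extension: \<open>tm\<close> provides enough pairs
        for a first signed zero sum, \<open>wm\<close> lets \<open>W\<close> absorb the length of a
        further one, and \<open>t0n\<close> makes it affordable to leave out \<open>m\<close>
        items.\<close>
      have t0n: "t0 + m + 1 < n" using sizes(1) f Et C c wn kn' by linarith
      have wm: "size W \<ge> 2 * m + 2" using sizes(1) f Et C t0n kn' by linarith
      have tm: "t0 \<ge> m + 1" using sizes(1) f Et C wn(1) kn' by linarith
      obtain J1 where J1: "\<forall>i\<in>#J1. is_Pr i" "size J1 = t0" "Refs J1 \<subseteq># C"
        using C(1) by (rule pair_items)
      define I0 where "I0 = image_mset Rot E + J1"
      have fJ1: "filter_mset is_Pr J1 = J1" using J1(1) by (simp add: filter_mset_eq_conv)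
      have len_le: "size (Rots U) + size (Refs U) \<le> 2 * size U" for U
        using size_Rots[of U] size_Refs[of U] by linarith
      define P where "P U \<longleftrightarrow> U \<subseteq># I0 \<and> reach (int k) U 0 \<and> size (filter_mset is_Pr U) > 0 \<and>
        size (Rots U) + size (Refs U) \<le> n" for U
      have "m + 1 \<le> size J1" using tm J1(2) by simp
      then obtain V0 where V0: "V0 \<subseteq># J1" "V0 \<noteq> {#}" "size V0 \<le> m + 1" "reach (int k) V0 0"
        using signed_pigeonhole[OF nkh(2), of "m + 1"] m(2) kn' by blast
      have "filter_mset is_Pr V0 = V0"
        using J1(1) V0(1) by (auto simp: filter_mset_eq_conv dest: mset_subset_eqD)
      moreover have "V0 \<subseteq># I0" using V0(1) by (simp add: I0_def subset_mset.add_increasing)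
      moreover have "size (Rots V0) + size (Refs V0) \<le> n" using len_le[of V0] V0(3) wm wn(1) by linarith
      ultimately have "P V0" using V0 by (simp add: P_def nonempty_has_size)
      moreover have "\<forall>U. P U \<longrightarrow> size U < Suc (size I0)" by (auto simp: P_def less_Suc_eq_le size_mset_mono)
      ultimately obtain U where U: "P U" and Umax: "\<And>V. P V \<Longrightarrow> size V \<le> size U"
        using ex_has_greatest_nat[of P V0 size "Suc (size I0)"] by blast
      obtain V where V: "I0 = U + V" using U by (auto simp: P_def mset_subset_eq_exists_conv)
      let ?l = "size (Rots U) + size (Refs U)"
      \<comment> \<open>Were \<open>U\<close> too short, a signed zero sum of at most
        \<open>m + 1\<close> remaining items could be added: its length is at most
        \<open>2 * m + 2 <= size W\<close>, so the total would not exceed \<open>n\<close>.\<close>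
      have "?l + size W \<ge> n"
      proof (rule ccontr)
        assume short: "\<not> ?thesis"
        show False
        proof (cases "m + 1 \<le> size V")
          case True
          then obtain Y where Y: "Y \<subseteq># V" "Y \<noteq> {#}" "size Y \<le> m + 1" "reach (int k) Y 0"
            using signed_pigeonhole[OF nkh(2), of "m + 1"] m(2) kn' by blast
          have "size (Rots Y) + size (Refs Y) \<le> size W" using len_le[of Y] Y(3) wm by linarith
          then have "size (Rots (U + Y)) + size (Refs (U + Y)) \<le> n" using short by simp
          then have "P (U + Y)"
            using U Y(1) reach_add[OF _ Y(4), of U 0] by (simp add: P_def V)
          then show False using Umax[of "U + Y"] Y(2) by simp
        next
          case False
          have "size (Rots I0) + size (Refs I0) = size E + 2 * t0"
            using J1 by (simp add: I0_def Rots_Pr size_Refs fJ1)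
          moreover have "size (Rots I0) + size (Refs I0) = ?l + (size (Rots V) + size (Refs V))"
            by (simp add: V)
          ultimately show False
            using False short len_le[of V] sizes(1) f C t0n by linarith
        qed
      qed
      then have "n - ?l \<le> size W" by simp
      then obtain W' where W': "W' \<subseteq># W" "size W' = n - ?l" by (rule ex_sub_mset_size)
      show ?thesis
      proof (rule finish[of "U + image_mset Rot W'"])
        show "reach (int k) (U + image_mset Rot W') 0"
        proof -
          have "reach (int k) (image_mset Rot W') 0"
            using W W'(1) by (intro reach_dvd) (auto dest: mset_subset_eqD)
          then show ?thesis using reach_add[of "int k" U 0] U by (auto simp: P_def)
        qed
        have "Rots U \<subseteq># Rots I0" "Refs U \<subseteq># Refs I0" using U Rots_mono Refs_mono by (auto simp: P_def)
        then have "Rots U \<subseteq># E" "Refs U \<subseteq># Refs J1" using J1(1) by (simp_all add: I0_def Rots_Pr)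
        then show "Rots (U + image_mset Rot W') \<subseteq># W + E" "Refs (U + image_mset Rot W') \<subseteq># C"
          using W'(1) J1(3) subset_mset.add_mono[of W' W "Rots U" E]
          by (auto simp: add.commute intro: subset_mset.order_trans)
        show "f2 + size (filter_mset is_Pr (U + image_mset Rot W')) > 0"
          using U unfolding P_def filter_union_mset size_union by linarith
        show "f1 + 2 * f2 + size (Rots (U + image_mset Rot W')) + size (Refs (U + image_mset Rot W')) = n"
          using U W'(2) f by (simp add: P_def)
      qed
    qed
  qed
qed

lemma has_one_product: "has_one_product n A B n \<or> has_one_product n A B (2 * n)"
proof -
  consider "k = 1" | "k \<ge> 3" using nkh(2,4) by (cases "k = 2") (auto, linarith)
  then show ?thesis
  proof cases
    case 1
    then show ?thesis using case_trivial by blast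
  next
    case 2
    then show ?thesis
      using unequal_pair_items[OF nkh(2), of C] case_majority[OF 2] case_no_majority[OF 2] by blast
  qed
qed

end

text \<open>With at most two reflections, \<open>m >= 1\<close> leaves at least
  \<open>2 * n - 1\<close> rotations. Otherwise the least \<open>k\<close> whose multiples can be
  filled, that is the largest subgroup, gives an instance of \<open>filling\<close>.\<close>

lemma has_one_product_length_n_or_2n:
  assumes n: "n \<ge> 3" "odd n" and m: "2 ^ m \<le> n" "n < 2 ^ (m + 1)"
    and size_AB: "size A + size B = 2 * n + m"
  shows "has_one_product n A B n \<or> has_one_product n A B (2 * n)"
proof (cases "size B \<ge> 3")
  case False
  have "m \<ge> 1" using m n by (cases m) auto
  then have "size A + 1 \<ge> 2 * n" using False size_AB by linarith
  then obtain T where "T \<subseteq># A" "size T = n" "int n dvd sum_mset T"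
    using erdos_ginzburg_ziv[of n A] n by auto
  then show ?thesis using has_one_product_rots[OF n(1)] by blast
next
  case True
  \<comment> \<open>\<open>A0\<close> omits one rotation, which provides the assumption \<open>spare\<close> of the locale.\<close>
  obtain A0 where A0: "A0 \<subseteq># A" "A = {#} \<or> size A0 < size A" "size A \<le> size A0 + 1"
  proof (cases A)
    case empty
    then show ?thesis using that[of "{#}"] by simp
  next
    case (add a A')
    then show ?thesis using that[of A'] by simp
  qed
  define Q where "Q k F \<longleftrightarrow> k dvd n \<and> Rots F \<subseteq># A0 \<and> Refs F \<subseteq># B \<and> (\<forall>i\<in>#F. int k dvd val i) \<and>
    size F + 1 \<le> n div k \<and> (\<forall>v. int k dvd v \<longrightarrow> reach (int n) F v)" for k F
  \<comment> \<open>The trivial subgroup is filled by nothing, so a least \<open>k\<close>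
    exists.\<close>
  have "Q n {#}" using n by (auto simp: Q_def reach_def cong_0_iff cong_sym_eq[of 0])
  define k where "k = (LEAST k. \<exists>F. Q k F)"
  have "\<exists>F. Q k F" unfolding k_def by (rule LeastI[of "\<lambda>k. \<exists>F. Q k F" n]) (use \<open>Q n {#}\<close> in blast)
  then obtain F where F: "Q k F" by blast
  have kmin: "\<not> Q k' F'" if "k' < k" for k' F'
    using not_less_Least[OF that[unfolded k_def]] by blast
  have Fsub: "Rots F \<subseteq># A0" "Refs F \<subseteq># B" and kn: "k dvd n" using F by (auto simp: Q_def)
  obtain D where D: "A0 = Rots F + D" using Fsub(1) by (auto simp: mset_subset_eq_exists_conv)
  obtain A1 where A1: "A = A0 + A1" using A0(1) by (auto simp: mset_subset_eq_exists_conv)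
  obtain C where B: "B = Refs F + C" using Fsub(2) by (auto simp: mset_subset_eq_exists_conv)
  define E0 where "E0 = filter_mset (\<lambda>a. \<not> int k dvd a) D"
  define E where "E = filter_mset (\<lambda>a. \<not> int k dvd a) (D + A1)"
  define W where "W = filter_mset (\<lambda>a. int k dvd a) (D + A1)"
  have "D + A1 = W + E" unfolding W_def E_def by (rule multiset_partition)
  then have A: "A = Rots F + W + E" by (simp add: A1 D add.assoc)
  have "size A1 \<le> 1" using A0(3) A1 by simp
  then have E_E0: "size E \<le> size E0 + 1"
    using order_trans[OF size_filter_mset_lesseq[of "\<lambda>a. \<not> int k dvd a" A1]]
    by (simp add: E_def E0_def)
  \<comment> \<open>Too many disjoint items that are nonzero modulo \<open>k\<close> would fill a
    larger subgroup modulo \<open>k\<close>; together with \<open>F\<close> they would contradict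
    the minimality of \<open>k\<close>.\<close>
  have few: "size E + size J + 1 \<le> k"
    if k2: "k \<ge> 2" and J: "\<forall>i\<in>#J. is_Pr i \<and> \<not> int k dvd val i" "Refs J \<subseteq># C" for J
  proof (rule ccontr)
    assume "\<not> ?thesis"
    \<comment> \<open>The failed bound gives one item more than required, which makes up for the
      omitted rotation that may count in \<open>E\<close> but not in \<open>E0\<close>.\<close>
    then have many: "size (image_mset Rot E0 + J) + 1 \<ge> k" using E_E0 by simp
    have "odd k" using kn n(2) dvd_trans by blast
    moreover have "\<forall>i\<in>#image_mset Rot E0 + J. \<not> int k dvd val i" using J(1) by (auto simp: E0_def)
    ultimately obtain k' J' where k': "k' dvd k" "k' < k" "J' \<subseteq># image_mset Rot E0 + J"
      and J': "\<forall>i\<in>#J'. int k' dvd val i" "size J' + 1 \<le> k div k'"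
      and fill: "\<forall>v. int k' dvd v \<longrightarrow> reach (int k) J' v"
      using items_fill_subgroup[OF k2 _ _ many] by blast
    have "Q k' (F + J')"
      unfolding Q_def
    proof (intro conjI)
      show "k' dvd n" using k'(1) kn by (rule dvd_trans)
      have "Rots J' \<subseteq># E0" "Refs J' \<subseteq># Refs J"
        using Rots_mono[OF k'(3)] Refs_mono[OF k'(3)] J(1) by (simp_all add: Rots_Pr)
      moreover have "E0 \<subseteq># D" by (simp add: E0_def)
      ultimately have "Rots J' \<subseteq># D" "Refs J' \<subseteq># C"
        using J(2) subset_mset.order_trans by blast+
      then show "Rots (F + J') \<subseteq># A0" "Refs (F + J') \<subseteq># B" by (simp_all add: D B)
      have "\<forall>i\<in>#F. int k' dvd val i"
        using F k'(1) dvd_trans[of "int k'" "int k"] by (auto simp: Q_def)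
      then show "\<forall>i\<in>#F + J'. int k' dvd val i" using J'(1) by auto
      \<comment> \<open>The bounds multiply, and \<open>(size F + 1) * (size J' + 1)\<close> is at
        least \<open>size F + size J' + 1\<close>.\<close>
      have "n div k' = (n div k) * (k div k')" using kn k'(1) by (simp add: dvd_div_mult mult.commute)
      moreover have "size F + 1 \<le> n div k" using F by (simp add: Q_def)
      then obtain a where "n div k = size F + 1 + a" using le_Suc_ex by blast
      moreover obtain b where "k div k' = size J' + 1 + b" using J'(2) le_Suc_ex by blast
      ultimately show "size (F + J') + 1 \<le> n div k'" by simp
      show "\<forall>v. int k' dvd v \<longrightarrow> reach (int n) (F + J') v"
        using fill F reach_fill[of "int k" J' _ "int n" F] by (auto simp: Q_def)
    qed
    then show False using kmin k'(2) by blast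
  qed
  interpret filling n m k A B F W E C
  proof
    show "Rots F = {#}" if "k = 1" "W = {#}"
    proof -
      have "E = {#}" using that(1) by (simp add: E_def)
      then have "A = Rots F" using A that(2) by simp
      then have "size A \<le> size A0" using D by simp
      then have "A = {#}" using A0(2) by simp
      then show ?thesis using A by simp
    qed
    show "\<forall>a\<in>#W. int k dvd a" "\<forall>a\<in>#E. \<not> int k dvd a" by (auto simp: W_def E_def)
  qed (use n m kn A B F True size_AB few in \<open>simp_all add: Q_def\<close>)
  show ?thesis by (rule has_one_product)
qed

section \<open>The case n dvd d\<close>

lemma one_product_seq_union:
  assumes "n \<ge> 3" "one_product_seq (dihedral_group n) S" "one_product_seq (dihedral_group n) T"
    "set_mset S \<subseteq> carrier (dihedral_group n)" "set_mset T \<subseteq> carrier (dihedral_group n)"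
  shows "one_product_seq (dihedral_group n) (S + T)"
proof -
  obtain gs hs where gs: "mset gs = S" "dprod n gs = \<one>\<^bsub>dihedral_group n\<^esub>"
    and hs: "mset hs = T" "dprod n hs = \<one>\<^bsub>dihedral_group n\<^esub>"
    using assms(2,3) by (auto simp: one_product_seq_def)
  have car: "set gs \<subseteq> carrier (dihedral_group n)" "set hs \<subseteq> carrier (dihedral_group n)"
    using gs(1) hs(1) assms(4,5) by auto
  have "dprod n (gs @ hs) = rotation n 0"
    using dprod_append[OF assms(1) car] gs(2) hs(2) by (simp add: dihedral_one[OF assms(1)] dihedral_mult[OF assms(1)])
  then show ?thesis
    unfolding one_product_seq_def using gs(1) hs(1)
    by (intro exI[of _ "gs @ hs"]) (simp add: dihedral_one[OF assms(1)])
qed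

lemma ex_one_product_length_n_or_2n:
  assumes n: "n \<ge> 3" "odd n" and m: "2 ^ m \<le> n" "n < 2 ^ (m + 1)"
    and S: "set_mset S \<subseteq> carrier (dihedral_group n)" "size S \<ge> 2 * n + m"
  shows "\<exists>T. T \<subseteq># S \<and> one_product_seq (dihedral_group n) T \<and> (size T = n \<or> size T = 2 * n)"
proof -
  obtain S' where S': "S' \<subseteq># S" "size S' = 2 * n + m" using ex_sub_mset_size[OF S(2)] by blast
  have "set_mset S' \<subseteq> carrier (dihedral_group n)" using S(1) set_mset_mono[OF S'(1)] by blast
  then obtain A B where AB: "S' = dseq n A B" using dseq_exists[OF n(1)] by blast
  have "has_one_product n A B n \<or> has_one_product n A B (2 * n)"
    using has_one_product_length_n_or_2n[OF n m] S'(2) AB by simp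
  then show ?thesis
    unfolding has_one_product_def using AB S'(1) subset_mset.order_trans by blast
qed

text \<open>One-product blocks of lengths \<open>n\<close> and \<open>2n\<close> are split off one after the other; \<open>u\<close> and \<open>v\<close>
  count the blocks of each kind.\<close>

lemma one_product_blocks:
  assumes n: "n \<ge> 3" "odd n" and m: "2 ^ m \<le> n" "n < 2 ^ (m + 1)"
    and S: "set_mset S \<subseteq> carrier (dihedral_group n)" "size S \<ge> n * (N + 1) + m"
  shows "\<exists>u v. N \<le> u + 2 * v \<and> (\<forall>u'\<le>u. \<forall>v'\<le>v. \<exists>T. T \<subseteq># S \<and>
    one_product_seq (dihedral_group n) T \<and> size T = (u' + 2 * v') * n)"
  using S
proof (induction N arbitrary: S rule: less_induct)
  case (less N)
  have empty: "one_product_seq (dihedral_group n) {#}"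
    unfolding one_product_seq_def by (rule exI[of _ "[]"]) simp
  show ?case
  proof (cases "N = 0")
    case True
    then show ?thesis using empty by (intro exI[of _ 0]) auto
  next
    case False
    then obtain N1 where N1: "N = Suc N1" by (cases N) auto
    have "n * (N + 1) + m \<ge> 2 * n + m" by (simp add: N1)
    then obtain X where X: "X \<subseteq># S" "one_product_seq (dihedral_group n) X" "size X = n \<or> size X = 2 * n"
      using ex_one_product_length_n_or_2n[OF n m less.prems(1)] less.prems(2) by (meson order_trans)
    obtain S' where S': "S = X + S'" using X(1) by (auto simp: mset_subset_eq_exists_conv)
    have car: "set_mset X \<subseteq> carrier (dihedral_group n)" "set_mset S' \<subseteq> carrier (dihedral_group n)"
      using less.prems(1) S' by auto
    have ext: "\<exists>T'. T' \<subseteq># S \<and> one_product_seq (dihedral_group n) T' \<and> size T' = size X + size T"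
      if T: "T \<subseteq># S'" "one_product_seq (dihedral_group n) T" for T
    proof -
      have "set_mset T \<subseteq> carrier (dihedral_group n)" using car(2) set_mset_mono[OF T(1)] by blast
      then have "one_product_seq (dihedral_group n) (X + T)"
        using one_product_seq_union[OF n(1) X(2) T(2) car(1)] by blast
      then show ?thesis using T(1) S' by (intro exI[of _ "X + T"]) simp
    qed
    have weak: "T \<subseteq># S" if "T \<subseteq># S'" for T using that S' by (simp add: subset_mset.add_increasing)
    from X(3) show ?thesis
    proof
      assume sX: "size X = n"
      have "size S' \<ge> n * (N1 + 1) + m" using less.prems(2) S' sX by (simp add: N1)
      from less.IH[OF _ car(2) this] obtain u v where uv: "N1 \<le> u + 2 * v"
        and T: "\<forall>u'\<le>u. \<forall>v'\<le>v. \<exists>T. T \<subseteq># S' \<and> one_product_seq (dihedral_group n) T \<and> size T = (u' + 2 * v') * n"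
        using N1 by blast
      have "\<exists>T. T \<subseteq># S \<and> one_product_seq (dihedral_group n) T \<and> size T = (u' + 2 * v') * n"
        if le: "u' \<le> Suc u" "v' \<le> v" for u' v'
      proof (cases "u' \<le> u")
        case True
        then show ?thesis using T le(2) weak by blast
      next
        case False
        then have "u' = Suc u" using le(1) by simp
        moreover obtain T' where "T' \<subseteq># S'" "one_product_seq (dihedral_group n) T'" "size T' = (u + 2 * v') * n"
          using T le(2) by blast
        ultimately show ?thesis using ext[of T'] sX by (simp add: add.assoc)
      qed
      then show ?thesis using uv N1 by (intro exI[of _ "Suc u"] exI[of _ v]) auto
    next
      assume sX: "size X = 2 * n"
      have "n * (N + 1) \<ge> 2 * n + n * (N - 1)" by (simp add: N1)
      moreover have "n * (N - 2 + 1) \<le> n * (N - 1) \<or> N = 1" using N1 by (cases N1) auto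
      ultimately have sS: "size S' + n \<ge> n * (N - 2 + 1) + m \<and> (N \<ge> 2 \<longrightarrow> size S' \<ge> n * (N - 2 + 1) + m)"
        using less.prems(2) S' sX N1 by (cases N1) auto
      have "\<exists>u v. N - 2 \<le> u + 2 * v \<and> (\<forall>u'\<le>u. \<forall>v'\<le>v. \<exists>T. T \<subseteq># S' \<and>
          one_product_seq (dihedral_group n) T \<and> size T = (u' + 2 * v') * n)"
      proof (cases "N \<ge> 2")
        case True
        then show ?thesis using less.IH[of "N - 2" S'] car(2) sS by simp
      next
        \<comment> \<open>For \<open>N = 1\<close> a block of length \<open>2 * n\<close> already
          overshoots, and no further block is needed.\<close>
        case False
        then show ?thesis using empty by (intro exI[of _ 0]) auto
      qed
      then obtain u v where uv: "N - 2 \<le> u + 2 * v"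
        and T: "\<forall>u'\<le>u. \<forall>v'\<le>v. \<exists>T. T \<subseteq># S' \<and> one_product_seq (dihedral_group n) T \<and> size T = (u' + 2 * v') * n"
        by blast
      have "\<exists>T. T \<subseteq># S \<and> one_product_seq (dihedral_group n) T \<and> size T = (u' + 2 * v') * n"
        if le: "u' \<le> u" "v' \<le> Suc v" for u' v'
      proof (cases "v' \<le> v")
        case True
        then show ?thesis using T le(1) weak by blast
      next
        case False
        then have "v' = Suc v" using le(2) by simp
        moreover obtain T' where "T' \<subseteq># S'" "one_product_seq (dihedral_group n) T'" "size T' = (u' + 2 * v) * n"
          using T le(1) by blast
        ultimately show ?thesis using ext[of T'] sX by (simp add: algebra_simps)
      qed
      then show ?thesis using uv by (intro exI[of _ u] exI[of _ "Suc v"]) auto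
    qed
  qed
qed

text \<open>With \<open>d = n * q\<close>, blocks of weight 1 and 2 and total weight at least
  \<open>2 * q - 1\<close> contain a selection of weight \<open>q\<close> or \<open>2 * q\<close>: a
  block of weight 1 settles the parity of \<open>q\<close>; without one there are \<open>q\<close>
  blocks of weight 2.\<close>

lemma upper_bound_dvd:
  assumes n: "n \<ge> 3" and m: "2 ^ m \<le> n" "n < 2 ^ (m + 1)" and d: "odd d" "n dvd d"
    and S: "set_mset S \<subseteq> carrier (dihedral_group n)" "size S \<ge> 2 * d + m"
  shows "\<exists>T. T \<subseteq># S \<and> T \<noteq> {#} \<and> one_product_seq (dihedral_group n) T \<and> d dvd size T"
proof -
  obtain q where q: "d = n * q" using d(2) by blast
  have odd: "odd n" "odd q" using d(1) q by auto
  have "n * (2 * q - 1 + 1) = 2 * d" using odd(2) q by (cases q) auto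
  then have "size S \<ge> n * (2 * q - 1 + 1) + m" using S(2) by simp
  from one_product_blocks[OF n odd(1) m S(1) this] obtain u v where uv: "2 * q - 1 \<le> u + 2 * v"
    and T: "\<forall>u'\<le>u. \<forall>v'\<le>v. \<exists>T. T \<subseteq># S \<and> one_product_seq (dihedral_group n) T \<and> size T = (u' + 2 * v') * n"
    by blast
  have q1: "q \<ge> 1" using odd(2) by (cases q) auto
  have "\<exists>u'\<le>u. \<exists>v'\<le>v. u' + 2 * v' = q \<or> u' + 2 * v' = 2 * q"
  proof (cases "u = 0")
    case True
    then have "q \<le> v" using uv by linarith
    then show ?thesis by (intro exI[of _ 0] conjI exI[of _ q]) auto
  next
    case False
    then have "u \<ge> 1 \<or> even q" by simp
    moreover have "q \<le> u + 2 * v" using uv q1 by linarith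
    ultimately obtain x y where "x \<le> u" "y \<le> v" "x + 2 * y = q" by (rule split_length)
    then show ?thesis by blast
  qed
  then obtain u' v' where "u' \<le> u" "v' \<le> v" and w: "u' + 2 * v' = q \<or> u' + 2 * v' = 2 * q" by blast
  then obtain T' where T': "T' \<subseteq># S" "one_product_seq (dihedral_group n) T'" "size T' = (u' + 2 * v') * n"
    using T by blast
  have "d dvd size T'" using w T'(3) by (auto simp: q)
  moreover have "size T' \<noteq> 0" using w T'(3) q1 n by auto
  then have "T' \<noteq> {#}" by auto
  ultimately show ?thesis using T' by blast
qed

section \<open>Extremal sequences and the lower bounds\<close>

lemma sub_dseq:
  assumes "T \<subseteq># dseq n A B"
  obtains A' B' where "A' \<subseteq># A" "B' \<subseteq># B" "T = dseq n A' B'"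
proof -
  let ?T1 = "T \<inter># image_mset (rotation n) A" and ?T2 = "T - image_mset (rotation n) A"
  obtain A' where A': "A' \<subseteq># A" "?T1 = image_mset (rotation n) A'"
    using sub_image_mset[of ?T1 "rotation n" A] by auto
  have "?T2 \<subseteq># image_mset (reflection n) B"
    using assms by (simp add: dseq_def subset_eq_diff_conv add.commute)
  then obtain B' where B': "B' \<subseteq># B" "?T2 = image_mset (reflection n) B'" by (rule sub_image_mset)
  have "T = ?T1 + ?T2" by (auto simp: multiset_eq_iff min_def)
  then show ?thesis using that[OF A'(1) B'(1)] A'(2) B'(2) by (simp add: dseq_def)
qed

text \<open>Every copy of x negates the exponent of what follows it, so the sign of a rotation is
  the parity of the reflections before it. In the induction a leading reflection swaps
  \<open>A1\<close> and \<open>A2\<close>.\<close>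

lemma dprod_refl_0:
  assumes n: "n \<ge> 3" and "mset gs = dseq n A B" "\<forall>b\<in>#B. b = 0"
  shows "\<exists>A1 A2. A = A1 + A2 \<and> (B = {#} \<longrightarrow> A2 = {#}) \<and>
    dprod n gs = (if even (size B) then rotation n else reflection n) (sum_mset A1 - sum_mset A2)"
  using assms(2,3)
proof (induction gs arbitrary: A B)
  case Nil
  then show ?case by (auto simp: dseq_def dihedral_one[OF n])
next
  case (Cons g gs)
  have "g \<in># dseq n A B" using Cons.prems(1) by (metis list.set_intros(1) set_mset_mset)
  then consider a where "a \<in># A" "g = rotation n a" | b where "b \<in># B" "g = reflection n b" by (auto simp: dseq_def)
  then show ?case
  proof cases
    case 1
    then obtain A' where A': "A = add_mset a A'" by (meson multi_member_split)
    then have "mset gs = dseq n A' B" using Cons.prems(1) 1 by (auto simp: dseq_def)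
    then obtain A1 A2 where IH: "A' = A1 + A2" "B = {#} \<longrightarrow> A2 = {#}"
      "dprod n gs = (if even (size B) then rotation n else reflection n) (sum_mset A1 - sum_mset A2)"
      using Cons.IH[of A' B] Cons.prems(2) by blast
    then show ?thesis
      using 1 by (intro exI[of _ "add_mset a A1"] exI[of _ A2])
        (auto simp: A' dihedral_mult[OF n] algebra_simps)
  next
    case 2
    then obtain B' where B': "B = add_mset b B'" by (meson multi_member_split)
    then have "mset gs = dseq n A B'" using Cons.prems(1) 2 by (auto simp: dseq_def)
    then obtain A1 A2 where IH: "A = A1 + A2"
      "dprod n gs = (if even (size B') then rotation n else reflection n) (sum_mset A1 - sum_mset A2)"
      using Cons.IH[of A B'] Cons.prems(2) B' by auto
    moreover have "b = 0" using Cons.prems(2) B' by simp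
    ultimately show ?thesis
      using 2 by (intro exI[of _ A2] exI[of _ A1]) (auto simp: B' dihedral_mult[OF n] add.commute)
  qed
qed

lemma one_product_seq_refl_0:
  assumes n: "n \<ge> 3" and "one_product_seq (dihedral_group n) (dseq n A B)" "\<forall>b\<in>#B. b = 0"
  shows "even (size B) \<and> (\<exists>A1 A2. A = A1 + A2 \<and> (B = {#} \<longrightarrow> A2 = {#}) \<and> int n dvd sum_mset A1 - sum_mset A2)"
proof -
  obtain gs where gs: "mset gs = dseq n A B" "dprod n gs = rotation n 0"
    using assms(2) by (auto simp: one_product_seq_def dihedral_one[OF n])
  obtain A1 A2 where A: "A = A1 + A2" "B = {#} \<longrightarrow> A2 = {#}"
    "rotation n 0 = (if even (size B) then rotation n else reflection n) (sum_mset A1 - sum_mset A2)"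
    using dprod_refl_0[OF n gs(1) assms(3)] gs(2) by auto
  have "even (size B)" using A(3) rot_neq_refl[OF n] by (auto split: if_splits)
  moreover from this have "int n dvd sum_mset A1 - sum_mset A2"
    using A(3) rot_eq_iff[OF n, of "sum_mset A1 - sum_mset A2" 0] by (simp add: cong_0_iff)
  ultimately show ?thesis using A(1,2) by blast
qed

text \<open>The highest power present outweighs every signed sum of distinct smaller powers.\<close>

lemma signed_powers_of_two:
  fixes A1 A2 :: "int multiset"
  assumes "A1 + A2 \<subseteq># image_mset (\<lambda>i. 2 ^ i) (mset_set {..<m})" "A1 + A2 \<noteq> {#}"
  shows "sum_mset A1 - sum_mset A2 \<noteq> 0 \<and> \<bar>sum_mset A1 - sum_mset A2\<bar> < 2 ^ m"
  using assms
proof (induction m arbitrary: A1 A2)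
  case 0
  then show ?case by simp
next
  case (Suc m)
  let ?M = "image_mset (\<lambda>i. (2::int) ^ i) (mset_set {..<m})"
  have M: "image_mset (\<lambda>i. (2::int) ^ i) (mset_set {..<Suc m}) = add_mset (2 ^ m) ?M"
    by (simp add: lessThan_Suc)
  have small: "\<bar>sum_mset C1 - sum_mset C2\<bar> < 2 ^ m" if "C1 + C2 \<subseteq># ?M" for C1 C2
    using Suc.IH[OF that] by (cases "C1 + C2 = {#}") auto
  consider "2 ^ m \<in># A1" | "2 ^ m \<in># A2" | "2 ^ m \<notin># A1 + A2" by auto
  then show ?case
  proof cases
    case 1
    then obtain C where C: "A1 = add_mset (2 ^ m) C" by (meson multi_member_split)
    have "\<bar>sum_mset C - sum_mset A2\<bar> < 2 ^ m" using Suc.prems(1) small[of C A2] by (simp add: M C)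
    then show ?thesis by (auto simp: C)
  next
    case 2
    then obtain C where C: "A2 = add_mset (2 ^ m) C" by (meson multi_member_split)
    have "\<bar>sum_mset A1 - sum_mset C\<bar> < 2 ^ m" using Suc.prems(1) small[of A1 C] by (simp add: M C)
    then show ?thesis by (auto simp: C)
  next
    case 3
    have "A1 + A2 \<subseteq># ?M"
      unfolding subseteq_mset_def
    proof
      fix a
      show "count (A1 + A2) a \<le> count ?M a"
        using 3 mset_subset_eq_count[OF Suc.prems(1)[unfolded M], of a]
        by (cases "a = 2 ^ m") (auto simp: not_in_iff)
    qed
    then show ?thesis using Suc.IH[of A1 A2] Suc.prems(2) by auto
  qed
qed

text \<open>The extremal sequence consists of y^(2^i) for \<open>i < m\<close> and
  \<open>2 * d - 1\<close> copies of x. As \<open>2 ^ m <= n\<close>, no nonempty signed sum of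
  these powers vanishes modulo \<open>n\<close>; only reflections remain, in a number that is even
  and divisible by the odd \<open>d\<close>.\<close>

lemma lower_bound_dvd:
  assumes n: "n \<ge> 3" and m: "2 ^ m \<le> n" and d: "odd d" "d \<ge> 1"
    and T: "T \<subseteq># dseq n (image_mset (\<lambda>i. 2 ^ i) (mset_set {..<m})) (replicate_mset (2 * d - 1) 0)"
      "one_product_seq (dihedral_group n) T" "d dvd size T"
  shows "T = {#}"
proof -
  obtain A B where AB: "A \<subseteq># image_mset (\<lambda>i. 2 ^ i) (mset_set {..<m})" "B \<subseteq># replicate_mset (2 * d - 1) 0"
    "T = dseq n A B" using sub_dseq[OF T(1)] by blast
  have "set_mset B \<subseteq> {0}" using set_mset_mono[OF AB(2)] by (auto simp: set_mset_replicate_mset_subset split: if_splits)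
  then have "\<forall>b\<in>#B. b = 0" by blast
  then have ev: "even (size B)" and ex: "\<exists>A1 A2. A = A1 + A2 \<and> int n dvd sum_mset A1 - sum_mset A2"
    using one_product_seq_refl_0[OF n T(2)[unfolded AB(3)]] by blast+
  have A0: "A = {#}"
  proof (rule ccontr)
    assume "A \<noteq> {#}"
    obtain A1 A2 where A: "A = A1 + A2" "int n dvd sum_mset A1 - sum_mset A2" using ex by blast
    have s: "sum_mset A1 - sum_mset A2 \<noteq> 0" "\<bar>sum_mset A1 - sum_mset A2\<bar> < 2 ^ m"
      using signed_powers_of_two[of A1 A2 m] AB(1) \<open>A \<noteq> {#}\<close> A(1) by auto
    have "int n \<le> \<bar>sum_mset A1 - sum_mset A2\<bar>" using dvd_imp_le_int[OF s(1) A(2)] by simp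
    moreover have "(2::int) ^ m \<le> int n" using m by (metis of_nat_le_iff of_nat_numeral of_nat_power)
    ultimately show False using s(2) by linarith
  qed
  have "size B \<le> 2 * d - 1" using size_mset_mono[OF AB(2)] by simp
  moreover have "2 * d dvd size B"
  proof -
    have "d dvd size B" using T(3) AB(3) A0 by simp
    moreover have "coprime 2 d" using d(1) by simp
    ultimately show ?thesis using ev by (simp add: divides_mult)
  qed
  ultimately have "size B = 0" using d(2) nat_dvd_not_less[of "size B" "2 * d"] by linarith
  then show ?thesis using AB(3) A0 by (simp add: dseq_def)
qed

text \<open>The extremal sequence has \<open>n * d - 1\<close> copies of y and one x. Parity
  excludes x, and then both \<open>n\<close> and \<open>d\<close> divide the length.\<close>

lemma lower_bound_coprime:
  assumes n: "n \<ge> 3" and d: "coprime n d" "d \<ge> 1"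
    and T: "T \<subseteq># dseq n (replicate_mset (n * d - 1) 1) {#0#}"
      "one_product_seq (dihedral_group n) T" "d dvd size T"
  shows "T = {#}"
proof -
  obtain A B where AB: "A \<subseteq># replicate_mset (n * d - 1) 1" "B \<subseteq># {#0#}" "T = dseq n A B"
    using sub_dseq[OF T(1)] by blast
  have "\<forall>b\<in>#B. b = 0" using AB(2) by (auto dest: mset_subset_eqD)
  from one_product_seq_refl_0[OF n _ this, of A] T(2) AB(3) have ev: "even (size B)"
    and ex: "B = {#} \<longrightarrow> int n dvd sum_mset A" by auto
  have "size B \<le> 1" using size_mset_mono[OF AB(2)] by simp
  then have B: "B = {#}" using ev by (cases "size B") auto
  have "A = replicate_mset (size A) 1"
    using AB(1) by (metis msubseteq_replicate_msetE size_replicate_mset)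
  then have "sum_mset A = int (size A)" by (metis mult.right_neutral sum_mset_replicate_mset of_nat_eq_id id_apply mult_1_right)
  then have "n dvd size A" using ex B by simp
  moreover have "d dvd size A" using T(3) AB(3) B by simp
  ultimately have "n * d dvd size A" using d(1) by (simp add: divides_mult)
  moreover have "size A \<le> n * d - 1" using size_mset_mono[OF AB(1)] by simp
  moreover have "n * d > 0" using n d(2) by simp
  ultimately have "size A = 0" using nat_dvd_not_less[of "size A" "n * d"] by linarith
  then show ?thesis using AB(3) B by (simp add: dseq_def)
qed

section \<open>From the two bounds to the value of the invariant\<close>

lemma s_dN_eqI:
  assumes "\<And>S. set_mset S \<subseteq> carrier G \<Longrightarrow> l \<le> size S \<Longrightarrow>
      \<exists>T. T \<subseteq># S \<and> T \<noteq> {#} \<and> one_product_seq G T \<and> d dvd size T"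
    and "set_mset S \<subseteq> carrier G" "size S + 1 = l"
    and "\<And>T. T \<subseteq># S \<Longrightarrow> one_product_seq G T \<Longrightarrow> d dvd size T \<Longrightarrow> T = {#}"
  shows "s_dN d G = enat l"
  unfolding s_dN_def
proof (rule Least_equality)
  fix y assume *: "\<forall>S. set_mset S \<subseteq> carrier G \<and> y \<le> enat (size S) \<longrightarrow>
    (\<exists>T. T \<subseteq># S \<and> T \<noteq> {#} \<and> one_product_seq G T \<and> d dvd size T)"
  show "enat l \<le> y"
  proof (rule ccontr)
    assume "\<not> ?thesis"
    then obtain z where "y = enat z" "z < l" by (cases y) auto
    then have "y \<le> enat (size S)" using assms(3) by simp
    then show False using * assms(2,4) by blast
  qed
qed (use assms(1) in simp)

section \<open>The coprime case\<close>

definition refl_count :: "nat \<Rightarrow> dihedral_gen word set list \<Rightarrow> nat" where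
  "refl_count n gs = length (filter (\<lambda>g. g \<in> range (reflection n)) gs)"

lemma dprod_parity:
  assumes n: "n \<ge> 3" and "set gs \<subseteq> carrier (dihedral_group n)"
  shows "dprod n gs \<in> (if even (refl_count n gs) then range (rotation n) else range (reflection n))"
  using assms(2)
proof (induction gs)
  case Nil
  then show ?case by (simp add: refl_count_def dihedral_one[OF n])
next
  case (Cons g gs)
  then have IH: "dprod n gs \<in> (if even (refl_count n gs) then range (rotation n) else range (reflection n))"
    and g: "g \<in> carrier (dihedral_group n)" by auto
  consider a where "g = rotation n a" | a where "g = reflection n a" using dihedral_cases[OF n g] by blast
  then show ?case
  proof cases
    case 1
    then have "g \<notin> range (reflection n)" using rot_neq_refl[OF n] by auto
    then show ?thesis using IH 1 by (auto simp: refl_count_def dihedral_mult[OF n] split: if_splits)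
  next
    case 2
    then show ?thesis using IH by (auto simp: refl_count_def dihedral_mult[OF n] split: if_splits)
  qed
qed

text \<open>Even reflection counts keep all \<open>n + 1\<close> prefix products among the
  \<open>n\<close> rotations; the blocks between two equal prefixes have product one.\<close>

lemma one_product_consecutive_blocks:
  assumes n: "n \<ge> 3" and d: "d \<ge> 1" and len: "length gss = n"
    and gss: "\<forall>gs\<in>set gss. set gs \<subseteq> carrier (dihedral_group n) \<and> length gs = d \<and> even (refl_count n gs)"
  shows "\<exists>T. T \<subseteq># mset (concat gss) \<and> T \<noteq> {#} \<and> one_product_seq (dihedral_group n) T \<and> d dvd size T"
proof -
  interpret G: group "dihedral_group n" by (rule group_dihedral_group)
  define p where "p i = dprod n (concat (take i gss))" for i
  have car: "set (concat hss) \<subseteq> carrier (dihedral_group n)" if "set hss \<subseteq> set gss" for hss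
    using gss that by auto
  have even_count: "even (refl_count n (concat hss))" if "set hss \<subseteq> set gss" for hss
    using that by (induction hss) (use gss in \<open>auto simp: refl_count_def\<close>)
  have rng: "p i \<in> rotation n ` {0..<int n}" for i
  proof -
    have "set (take i gss) \<subseteq> set gss" by (rule set_take_subset)
    then have "p i \<in> range (rotation n)"
      using dprod_parity[OF n car] even_count unfolding p_def by fastforce
    then obtain a where "p i = rotation n a" by blast
    then have "p i = rotation n (a mod int n)" using rot_eq_iff[OF n, of a "a mod int n"] by (simp add: cong_def)
    then show ?thesis using n by auto
  qed
  have "card (p ` {..n}) \<le> card (rotation n ` {0..<int n})" using rng by (intro card_mono) auto
  also have "\<dots> \<le> n" using card_image_le[of "{0..<int n}" "rotation n"] by simp
  finally have "card (p ` {..n}) < card {..n}" by simp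
  then have "\<not> inj_on p {..n}" by (rule pigeonhole)
  then obtain i j where ij: "i < j" "j \<le> n" "p i = p j"
    unfolding inj_on_def by (metis atMost_iff linorder_neqE_nat)
  define hss where "hss = take (j - i) (drop i gss)"
  have tj: "take j gss = take i gss @ hss"
    using ij(1) unfolding hss_def by (metis le_add_diff_inverse less_imp_le_nat take_add)
  have sub: "set hss \<subseteq> set gss" "set (take i gss) \<subseteq> set gss"
    unfolding hss_def by (meson set_drop_subset set_take_subset order_trans)+
  have "p j = p i \<otimes>\<^bsub>dihedral_group n\<^esub> dprod n (concat hss)"
    unfolding p_def tj using dprod_append[OF n car car] sub by simp
  then have "dprod n (concat hss) = \<one>\<^bsub>dihedral_group n\<^esub>"
    using ij(3) G.l_cancel_one' dprod_carrier[OF n car[OF sub(1)]] dprod_carrier[OF n car[OF sub(2)]]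
    by (metis p_def)
  then have "one_product_seq (dihedral_group n) (mset (concat hss))"
    unfolding one_product_seq_def by blast
  moreover have "length (concat hss) = d * length hss"
    using sub(1) by (induction hss) (use gss in auto)
  moreover have "length hss > 0" using ij len by (simp add: hss_def)
  moreover have "mset (concat hss) \<subseteq># mset (concat gss)"
  proof -
    have "gss = take i gss @ hss @ drop j gss" using tj by (metis append.assoc append_take_drop_id)
    then have "mset (concat gss) = mset (concat (take i gss)) + (mset (concat hss) + mset (concat (drop j gss)))"
      by (metis concat_append mset_append)
    then show ?thesis by (simp add: subset_mset.add_increasing)
  qed
  moreover have "mset (concat hss) \<noteq> {#}"
  proof
    assume "mset (concat hss) = {#}"
    then have "length (concat hss) = 0" by simp
    then show False using \<open>length (concat hss) = d * length hss\<close> \<open>length hss > 0\<close> d by simp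
  qed
  ultimately show ?thesis by (metis dvd_triv_left size_mset)
qed

section \<open>Cutting into blocks with an even number of reflections\<close>

lemma refl_count_append [simp]: "refl_count n (gs @ hs) = refl_count n gs + refl_count n hs"
  by (simp add: refl_count_def)

lemma refl_count_maps:
  assumes n: "n \<ge> 3"
  shows "refl_count n (map (rotation n) as) = 0" "refl_count n (map (reflection n) bs) = length bs"
proof -
  have "rotation n a \<notin> range (reflection n)" for a using rot_neq_refl[OF n] by auto
  then show "refl_count n (map (rotation n) as) = 0" by (simp add: refl_count_def)
  have "filter (\<lambda>g. g \<in> range (reflection n)) (map (reflection n) bs) = map (reflection n) bs" by (rule filter_True) auto
  then show "refl_count n (map (reflection n) bs) = length bs" by (simp add: refl_count_def)
qed

text \<open>With the rotations listed first, at most one chunk is mixed. The chunks after it consist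
  of \<open>e\<close> reflections each, so evenness of \<open>e\<close> and of the number of
  reflections makes the mixed one even too.\<close>

lemma balanced_chunks:
  assumes n: "n \<ge> 3" and "even e" "even (length bs)" "length as + length bs = N * e"
  shows "\<exists>gss. length gss = N \<and> concat gss = map (rotation n) as @ map (reflection n) bs \<and>
    (\<forall>gs\<in>set gss. length gs = e \<and> even (refl_count n gs))"
  using assms(3,4)
proof (induction N arbitrary: as bs)
  case 0
  then show ?case by simp
next
  case (Suc N)
  show ?case
  proof (cases "e \<le> length as")
    case True
    have "length (drop e as) + length bs = N * e" using Suc.prems(2) True by simp
    from Suc.IH[OF Suc.prems(1) this] obtain gss where gss: "length gss = N"
      "concat gss = map (rotation n) (drop e as) @ map (reflection n) bs"
      "\<forall>gs\<in>set gss. length gs = e \<and> even (refl_count n gs)" by blast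
    have "concat (map (rotation n) (take e as) # gss) = map (rotation n) as @ map (reflection n) bs"
      using gss(2) by (simp flip: map_append append.assoc)
    then show ?thesis
      using gss(1,3) True by (intro exI[of _ "map (rotation n) (take e as) # gss"])
        (auto simp: refl_count_maps[OF n] simp del: concat.simps)
  next
    case False
    define l where "l = e - length as"
    have "even (length as + length bs)" unfolding Suc.prems(2) using assms(2) by simp
    then have el: "even l" using assms(2) Suc.prems(1) False by (simp add: l_def)
    have ll: "l \<le> length bs" using Suc.prems(2) False by (simp add: l_def)
    have "even (length (drop l bs))" "length ([]::int list) + length (drop l bs) = N * e"
      using el ll Suc.prems False by (auto simp: l_def)
    from Suc.IH[OF this] obtain gss where gss: "length gss = N"
      "concat gss = map (rotation n) [] @ map (reflection n) (drop l bs)"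
      "\<forall>gs\<in>set gss. length gs = e \<and> even (refl_count n gs)" by blast
    let ?g = "map (rotation n) as @ map (reflection n) (take l bs)"
    have "concat (?g # gss) = map (rotation n) as @ map (reflection n) bs"
      using gss(2) by (simp flip: map_append)
    moreover have "length ?g = e" using False ll by (simp add: l_def)
    moreover have "even (refl_count n ?g)" using el ll by (simp add: refl_count_maps[OF n])
    ultimately show ?thesis
      using gss(1,3) by (intro exI[of _ "?g # gss"]) (auto simp del: concat.simps)
  qed
qed

lemma two_sub_mset:
  assumes "i < length xs" "j < length xs" "i \<noteq> j"
  shows "{#xs ! i, xs ! j#} \<subseteq># mset xs"
proof -
  have "{#xs ! i, xs ! j#} = image_mset ((!) xs) (mset_set {i, j})" using assms(3) by simp
  also have "\<dots> \<subseteq># image_mset ((!) xs) (mset_set {0..<length xs})"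
    using assms by (intro image_mset_subseteq_mono subset_imp_msubset_mset_set) auto
  also have "\<dots> = mset xs" by (metis map_nth mset_map mset_upt)
  finally show ?thesis .
qed

text \<open>The residues of the reflections and the partial sums of the rotations, translated by one reflection,
  are \<open>n + 1\<close> numbers modulo \<open>n\<close>; each kind of coincidence yields a one-product subsequence.\<close>

lemma davenport_dihedral:
  assumes n: "n \<ge> 3" and size: "size A + size B = n + 1"
  shows "\<exists>l>0. has_one_product n A B l"
proof -
  obtain as bs where as: "mset as = A" and bs: "mset bs = B" using ex_mset by metis
  define s where "s = length bs"
  have len: "s + length as = n + 1" using size as bs by (auto simp: s_def)
  define P where "P l = sum_list (take l as)" for l
  \<comment> \<open>Index \<open>s\<close> stands for the partial sum of length 1; the empty one is
    represented by \<open>bs ! 0\<close> itself. Without reflections \<open>bs ! 0\<close> is an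
    unspecified constant, which cancels in the last case.\<close>
  define f where "f i = (if i < s then bs ! i else bs ! 0 + P (i + 1 - s)) mod int n" for i
  have segment: "\<exists>l>0. has_one_product n A B l"
    if l: "l < l'" "l' \<le> length as" "[P l = P l'] (mod int n)" for l l'
  proof -
    define T where "T = take (l' - l) (drop l as)"
    have tk: "take l' as = take l as @ T"
      using l(1) unfolding T_def by (metis le_add_diff_inverse less_imp_le_nat take_add)
    have "as = take l as @ T @ drop l' as" using tk by (metis append.assoc append_take_drop_id)
    then have "A = mset (take l as) + (mset T + mset (drop l' as))" using as by (metis mset_append)
    then have "mset T \<subseteq># A" by (simp add: subset_mset.add_increasing)
    moreover have "P l' = P l + sum_list T" by (simp add: P_def tk)
    then have "int n dvd sum_mset (mset T)"
      using cong_sym[OF l(3)] by (simp add: cong_iff_dvd_diff sum_mset_sum_list)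
    ultimately have "has_one_product n A B (size (mset T))" by (rule has_one_product_rots[OF n])
    moreover have "size (mset T) > 0" using l by (simp add: T_def)
    ultimately show ?thesis by blast
  qed
  have "card (f ` {..n}) \<le> card {0..<int n}" using n by (intro card_mono) (auto simp: f_def)
  then have "card (f ` {..n}) < card {..n}" by simp
  then have "\<not> inj_on f {..n}" by (rule pigeonhole)
  then obtain i j where ij: "i < j" "j \<le> n" "f i = f j"
    unfolding inj_on_def by (metis atMost_iff linorder_neqE_nat)
  consider "j < s" | "i < s" "s \<le> j" "i = 0" | "i < s" "s \<le> j" "i > 0" | "s \<le> i" by linarith
  then show ?thesis
  proof cases
    case 1
    let ?I = "{#Pr (bs ! i) (bs ! j)#}"
    have "reach (int n) ?I 0"
      using ij(1,3) 1 by (intro reach_dvd) (auto simp: f_def mod_eq_dvd_iff)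
    moreover have "Refs ?I \<subseteq># B" using two_sub_mset[of i bs j] 1 ij(1) bs by (simp add: s_def)
    ultimately have "has_one_product n A B 2" by (intro has_one_product_items[OF n]) auto
    then show ?thesis by (intro exI[of _ 2]) simp
  next
    case 2
    then have "[P 0 = P (j + 1 - s)] (mod int n)"
      using ij(3) by (auto simp: f_def P_def cong_iff_dvd_diff mod_eq_dvd_iff)
    then show ?thesis using segment[of 0 "j + 1 - s"] 2 ij(2) len by simp
  next
    case 3
    let ?l = "j + 1 - s"
    \<comment> \<open>The pair has value \<open>P ?l\<close> modulo \<open>n\<close>, so the
      rotations enter with sign minus.\<close>
    let ?I = "add_mset (Pr (bs ! i) (bs ! 0)) (image_mset Rot (mset (take ?l as)))"
    have "Val (image_mset Rot X) = sum_mset X" for X by (induction X) auto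
    then have "[Val {#Pr (bs ! i) (bs ! 0)#} - Val (image_mset Rot (mset (take ?l as))) = 0] (mod int n)"
      using ij(3) 3 by (simp add: f_def P_def cong_iff_dvd_diff mod_eq_dvd_iff sum_mset_sum_list diff_diff_eq)
    then have "reach (int n) ?I 0"
      unfolding reach_def
      by (intro exI[of _ "{#Pr (bs ! i) (bs ! 0)#}"] exI[of _ "image_mset Rot (mset (take ?l as))"]) simp
    moreover have "mset (take ?l as) \<subseteq># A"
      unfolding as[symmetric] by (metis append_take_drop_id mset_append mset_subset_eq_add_left)
    moreover have "0 < length bs" using 3(1) unfolding s_def by linarith
    then have "Refs ?I \<subseteq># B" using two_sub_mset[of i bs 0] 3 bs by (simp add: s_def)
    ultimately have "has_one_product n A B (size (Rots ?I) + size (Refs ?I))"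
      by (intro has_one_product_items[OF n]) auto
    then show ?thesis by (intro exI[of _ "size (Rots ?I) + size (Refs ?I)"]) simp
  next
    case 4
    then have "[P (i + 1 - s) = P (j + 1 - s)] (mod int n)"
      using ij by (auto simp: f_def cong_iff_dvd_diff mod_eq_dvd_iff)
    then show ?thesis using segment[of "i + 1 - s" "j + 1 - s"] 4 ij len by simp
  qed
qed

text \<open>With many reflections, \<open>d\<close> congruent pairs give length
  \<open>2 * d\<close>. Otherwise, for \<open>d > 1\<close>, dropping one term makes the number of
  reflections even, and the remaining \<open>n * d\<close> terms are cut into \<open>n\<close>
  blocks; for odd \<open>d\<close> a block is one rotation followed by an even chunk of length
  \<open>d - 1\<close>.\<close>

lemma upper_bound_coprime:
  assumes n: "n \<ge> 3" and d: "d \<ge> 1" "coprime n d"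
    and S: "set_mset S \<subseteq> carrier (dihedral_group n)" "size S \<ge> n * d + 1"
  shows "\<exists>T. T \<subseteq># S \<and> T \<noteq> {#} \<and> one_product_seq (dihedral_group n) T \<and> d dvd size T"
proof -
  obtain S' where S': "S' \<subseteq># S" "size S' = n * d + 1" using ex_sub_mset_size[OF S(2)] by blast
  have "set_mset S' \<subseteq> carrier (dihedral_group n)" using S(1) set_mset_mono[OF S'(1)] by blast
  then obtain A B where AB: "S' = dseq n A B" using dseq_exists[OF n] by blast
  have size: "size A + size B = n * d + 1" using S'(2) AB by simp
  have lift: ?thesis if "T \<subseteq># dseq n A B" "T \<noteq> {#}" "one_product_seq (dihedral_group n) T" "d dvd size T" for T
    using that AB S'(1) subset_mset.order_trans by blast
  have hop: ?thesis if l: "has_one_product n A B l" "d dvd l" "l > 0" for l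
  proof -
    obtain T where T: "T \<subseteq># dseq n A B" "one_product_seq (dihedral_group n) T" "size T = l"
      using l(1) by (auto simp: has_one_product_def)
    then have "T \<noteq> {#}" using l(3) by auto
    then show ?thesis using lift[of T] T l(2) by blast
  qed
  show ?thesis
  proof (cases "2 * d + n \<le> size B + 1")
    case True
    have "n > 0" using n by simp
    from equal_pair_items[OF this True] obtain J
      where J: "\<forall>i\<in>#J. is_Pr i \<and> int n dvd val i" "size J = d" "Refs J \<subseteq># B" by blast
    have fJ: "filter_mset is_Pr J = J" using J(1) by (simp add: filter_mset_eq_conv)
    have "has_one_product n A B (2 * d)"
    proof (rule has_one_product_items[OF n])
      show "reach (int n) J 0" using J(1) by (intro reach_dvd) auto
      show "size (Rots J) + size (Refs J) = 2 * d" using J by (simp add: Rots_Pr size_Refs fJ)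
    qed (use J d fJ in \<open>auto simp: Rots_Pr\<close>)
    then show ?thesis using hop[of "2 * d"] d(1) by simp
  next
    case False
    then have few: "size B + 2 \<le> 2 * d + n" by simp
    show ?thesis
    proof (cases "d = 1")
      case True
      then show ?thesis using davenport_dihedral[OF n, of A B] size hop by auto
    next
      case d1: False
      \<comment> \<open>For odd \<open>d\<close> each block needs a rotation, and one more may be
        dropped for parity. For \<open>n\<close> and \<open>d\<close> at least 3 the inequality
        fails only at \<open>n = d = 3\<close>, which coprimality excludes.\<close>
      have rots: "odd d \<Longrightarrow> size A \<ge> n + 1"
      proof -
        assume "odd d"
        then have d3: "d \<ge> 3" using d(1) d1 by presburger
        have "n \<noteq> 3 \<or> d \<noteq> 3" using d(2) by auto
        then have "2 * n + 2 * d \<le> n * d + 2"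
        proof -
          obtain a b where "n = 3 + a" "d = 3 + b" using n d3 le_Suc_ex by metis
          then show ?thesis using \<open>n \<noteq> 3 \<or> d \<noteq> 3\<close> by (cases a; cases b) (auto simp: algebra_simps)
        qed
        then show ?thesis using few size by linarith
      qed
      obtain A' B' where A'B': "A' \<subseteq># A" "B' \<subseteq># B" "even (size B')" "size A' + size B' = n * d"
        "size A \<le> size A' + 1"
      proof (cases "even (size B)")
        case True
        \<comment> \<open>An even number of reflections and no rotation would make
          \<open>n * d + 1\<close> even, hence \<open>d\<close> odd, against
          \<open>rots\<close>.\<close>
        have "size A \<noteq> 0"
        proof
          assume "size A = 0"
          then have "odd (n * d)" using True size by (metis add_0 even_plus_one_iff)
          then show False using rots \<open>size A = 0\<close> by simp
        qed
        then obtain a A' where "A = add_mset a A'" by (cases A) auto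
        then show ?thesis using that[of A' B] True size by simp
      next
        case False
        then obtain b B' where "B = add_mset b B'" by (cases B) auto
        then show ?thesis using that[of A B'] False size by simp
      qed
      obtain as bs where as: "mset as = A'" and bs: "mset bs = B'" using ex_mset by metis
      have len: "length as + length bs = n * d" "even (length bs)" using A'B'(3,4) as bs by auto
      have "\<exists>gss. length gss = n \<and> mset (concat gss) = dseq n A' B' \<and>
        (\<forall>gs\<in>set gss. length gs = d \<and> even (refl_count n gs))"
      proof (cases "even d")
        case True
        from balanced_chunks[OF n True len(2,1)] obtain gss where gss: "length gss = n"
          "concat gss = map (rotation n) as @ map (reflection n) bs"
          "\<forall>gs\<in>set gss. length gs = d \<and> even (refl_count n gs)" by blast
        have "mset (concat gss) = dseq n A' B'" unfolding gss(2) by (simp add: dseq_def as bs)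
        then show ?thesis using gss by blast
      next
        case False
        then have "size A' \<ge> n" using rots A'B'(5) by simp
        then have la: "length as \<ge> n" using as by auto
        have "length (drop n as) + length bs = n * (d - 1)"
          using len(1) la by (simp add: diff_mult_distrib2)
        moreover have "even (d - 1)" using False by simp
        ultimately obtain gss where gss: "length gss = n"
          "concat gss = map (rotation n) (drop n as) @ map (reflection n) bs"
          "\<forall>gs\<in>set gss. length gs = d - 1 \<and> even (refl_count n gs)"
          using balanced_chunks[OF n _ len(2)] by blast
        define hss where "hss = map2 (\<lambda>a gs. rotation n a # gs) (take n as) gss"
        have "mset (concat (map2 (\<lambda>a gs. rotation n a # gs) us vss)) = image_mset (rotation n) (mset us) + mset (concat vss)"
          if "length us = length vss" for us vss
          using that by (induction us vss rule: list_induct2) auto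
        then have "mset (concat hss) = image_mset (rotation n) (mset (take n as)) + mset (concat gss)"
          using gss(1) la by (simp add: hss_def)
        also have "\<dots> = image_mset (rotation n) (mset (take n as) + mset (drop n as)) + image_mset (reflection n) (mset bs)"
          by (simp add: gss(2))
        also have "mset (take n as) + mset (drop n as) = mset as" by (metis append_take_drop_id mset_append)
        finally have "mset (concat hss) = dseq n A' B'" by (simp add: dseq_def as bs)
        moreover have "length hss = n" using gss(1) la by (simp add: hss_def)
        moreover have "length hs = d \<and> even (refl_count n hs)" if hs: "hs \<in> set hss" for hs
        proof -
          obtain a gs where gs: "gs \<in> set gss" "hs = rotation n a # gs"
            using hs by (auto simp: hss_def dest!: set_zip_rightD)
          have "refl_count n hs = refl_count n gs"
            using refl_count_append[of n "map (rotation n) [a]" gs] refl_count_maps(1)[OF n, of "[a]"] gs(2) by simp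
          then show ?thesis using gss(3) gs d(1) by auto
        qed
        ultimately show ?thesis by blast
      qed
      then obtain gss where gss: "length gss = n" "mset (concat gss) = dseq n A' B'"
        "\<forall>gs\<in>set gss. length gs = d \<and> even (refl_count n gs)" by blast
      have "set (concat gss) \<subseteq> carrier (dihedral_group n)"
        using dseq_carrier[of n A' B'] gss(2) by (metis set_mset_mset)
      then have "\<forall>gs\<in>set gss. set gs \<subseteq> carrier (dihedral_group n) \<and> length gs = d \<and> even (refl_count n gs)"
        using gss(3) by auto
      from one_product_consecutive_blocks[OF n d(1) gss(1) this] obtain T
        where T: "T \<subseteq># dseq n A' B'" "T \<noteq> {#}" "one_product_seq (dihedral_group n) T" "d dvd size T"
        unfolding gss(2) by blast
      have "T \<subseteq># dseq n A B"
        using T(1) dseq_mono[OF A'B'(1,2)] by (rule subset_mset.order_trans)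
      then show ?thesis using lift T by blast
    qed
  qed
qed

theorem theorem1p4:
  fixes n d :: nat
  assumes "n \<ge> 3" and "d \<ge> 1"
  shows "(odd d \<and> n dvd d \<longrightarrow>
            s_dN d (dihedral_group n) = enat (2 * d + nat \<lfloor>log 2 (real n)\<rfloor>)) \<and>
         (coprime n d \<longrightarrow> s_dN d (dihedral_group n) = enat (n * d + 1))"
proof (intro conjI impI)
  assume d: "odd d \<and> n dvd d"
  obtain m where m: "2 ^ m \<le> n" "n < 2 ^ (m + 1)" using ex_log2[of n] assms(1) by auto
  have "\<lfloor>log 2 (real n)\<rfloor> = int m"
    using floor_log_nat_eq_powr_iff[of 2 n m] m assms(1) by simp
  moreover have "m \<ge> 1" using m assms(1) by (cases m) auto
  moreover have "s_dN d (dihedral_group n) = enat (2 * d + m)"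
  proof (rule s_dN_eqI)
    show "\<exists>T. T \<subseteq># S \<and> T \<noteq> {#} \<and> one_product_seq (dihedral_group n) T \<and> d dvd size T"
      if "set_mset S \<subseteq> carrier (dihedral_group n)" "2 * d + m \<le> size S" for S
      using upper_bound_dvd[OF assms(1) m] d that by blast
    let ?S = "dseq n (image_mset (\<lambda>i. 2 ^ i) (mset_set {..<m})) (replicate_mset (2 * d - 1) 0)"
    show "set_mset ?S \<subseteq> carrier (dihedral_group n)" by (rule dseq_carrier)
    show "size ?S + 1 = 2 * d + m" using assms(2) by simp
    show "T = {#}" if "T \<subseteq># ?S" "one_product_seq (dihedral_group n) T" "d dvd size T" for T
      using lower_bound_dvd[OF assms(1) m(1)] d assms(2) that by blast
  qed
  ultimately show "s_dN d (dihedral_group n) = enat (2 * d + nat \<lfloor>log 2 (real n)\<rfloor>)" by simp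
next
  assume d: "coprime n d"
  show "s_dN d (dihedral_group n) = enat (n * d + 1)"
  proof (rule s_dN_eqI)
    show "\<exists>T. T \<subseteq># S \<and> T \<noteq> {#} \<and> one_product_seq (dihedral_group n) T \<and> d dvd size T"
      if "set_mset S \<subseteq> carrier (dihedral_group n)" "n * d + 1 \<le> size S" for S
      using upper_bound_coprime[OF assms d that] .
    let ?S = "dseq n (replicate_mset (n * d - 1) 1) {#0#}"
    show "set_mset ?S \<subseteq> carrier (dihedral_group n)" by (rule dseq_carrier)
    show "size ?S + 1 = n * d + 1" using assms by simp
    show "T = {#}" if "T \<subseteq># ?S" "one_product_seq (dihedral_group n) T" "d dvd size T" for T
      using lower_bound_coprime[OF assms(1) d assms(2) that] .
  qed
qed

end
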